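(* Let $\mathscr{K}$ be an essentially small monoidal-triangulated category. The compact elements of the lattice of semiprime thick $\otimes$-ideals $T_s(\mathscr{K})$ are precisely the principal ideals $\langle x\rangle_s$, $x\in\mathscr{K}$, if and only if $\mathscr{K}$ has compact detection.
   Context: A monoidal-triangulated category is a triangulated category $\mathscr{K}$ with a monoidal structure $(\otimes,\mathbb{1})$, not assumed symmetric or braided, such that $\otimes$ is exact in each variable. A thick subcategory is a full triangulated subcategory closed under direct summands; a thick $\otimes$-ideal is a thick subcategory $\mathscr{I}$ with $x\otimes y,\ y\otimes x\in\mathscr{I}$ for all $x\in\mathscr{I}$, $y\in\mathscr{K}$. A proper thick $\otimes$-ideal $\mathscr{P}$ is prime if for all thick $\otimes$-ideals $\mathscr{I},\mathscr{J}$, $\mathscr{I}\otimes\mathscr{J}\subseteq\mathscr{P}$ implies $\mathscr{I}\subseteq\mathscr{P}$ or $\mathscr{J}\subseteq\mathscr{P}$. A thick $\otimes$-ideal is semiprime if it is an intersection of primes ($\mathscr{K}$ being the empty intersection). $T_s(\mathscr{K})$ is the complete lattice of semiprime thick $\otimes$-ideals ordered by inclusion; $\langle S\rangle_s$ is the smallest semiprime thick $\otimes$-ideal containing $S$; joins are $\bigvee_i\mathscr{J}_i=\langle\bigcup_i\mathscr{J}_i\rangle_s$. An element $c$ of a complete lattice is compact if $c\le\bigvee S$ implies $c\le\bigvee S'$ for some finite $S'\subseteq S$. $\mathscr{K}$ has compact detection if for all $x\in\mathscr{K}$ there is $s_x\in\mathscr{K}$ such that for every semiprime thick $\otimes$-ideal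 $\mathscr{I}$: $x\in\mathscr{I}$ if and only if $x\otimes s_x\otimes x\in\mathscr{I}$. *)

theory Defs
  imports "HOL-Algebra.Group"
begin

section \<open>Categories, endofunctors, natural isomorphisms\<close>

text \<open>
  Objects and arrows are carrier sets inside HOL types, so every category in this sense is small;
  an essentially small category is, up to equivalence, one of these. Every arrow has a unique
  domain and codomain. The operations are only constrained on their intended arguments.
\<close>

record ('o, 'a) category =
  Obj :: "'o set"
  Arr :: "'a set"
  Dom :: "'a \<Rightarrow> 'o"
  Cod :: "'a \<Rightarrow> 'o"
  Ident :: "'o \<Rightarrow> 'a"
  Comp :: "'a \<Rightarrow> 'a \<Rightarrow> 'a" (infixl "\<cdot>\<index>" 75)

definition Hom :: "('o, 'a, 'e) category_scheme \<Rightarrow> 'o \<Rightarrow> 'o \<Rightarrow> 'a set" where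
  "Hom C X Y = {f \<in> Arr C. Dom C f = X \<and> Cod C f = Y}"

locale category =
  fixes C :: "('o, 'a, 'e) category_scheme" (structure)
  assumes Dom_Obj: "f \<in> Arr C \<Longrightarrow> Dom C f \<in> Obj C"
    and Cod_Obj: "f \<in> Arr C \<Longrightarrow> Cod C f \<in> Obj C"
    and Ident_Hom: "X \<in> Obj C \<Longrightarrow> Ident C X \<in> Hom C X X"
    and Comp_Hom: "\<lbrakk>f \<in> Hom C X Y; g \<in> Hom C Y Z\<rbrakk> \<Longrightarrow> g \<cdot> f \<in> Hom C X Z"
    and Comp_Ident: "f \<in> Hom C X Y \<Longrightarrow> f \<cdot> Ident C X = f"
    and Ident_Comp: "f \<in> Hom C X Y \<Longrightarrow> Ident C Y \<cdot> f = f"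
    and Comp_assoc: "\<lbrakk>f \<in> Hom C W X; g \<in> Hom C X Y; h \<in> Hom C Y Z\<rbrakk>
          \<Longrightarrow> (h \<cdot> g) \<cdot> f = h \<cdot> (g \<cdot> f)"

definition is_iso :: "('o, 'a, 'e) category_scheme \<Rightarrow> 'o \<Rightarrow> 'o \<Rightarrow> 'a \<Rightarrow> bool" where
  "is_iso C X Y f \<longleftrightarrow> f \<in> Hom C X Y \<and>
     (\<exists>g \<in> Hom C Y X. g \<cdot>\<^bsub>C\<^esub> f = Ident C X \<and> f \<cdot>\<^bsub>C\<^esub> g = Ident C Y)"

definition isomorphic :: "('o, 'a, 'e) category_scheme \<Rightarrow> 'o \<Rightarrow> 'o \<Rightarrow> bool" where
  "isomorphic C X Y \<longleftrightarrow> (\<exists>f. is_iso C X Y f)"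

record ('o, 'a) endofunctor =
  on_obj :: "'o \<Rightarrow> 'o"
  on_arr :: "'a \<Rightarrow> 'a"

definition is_endofunctor ::
  "('o, 'a, 'e) category_scheme \<Rightarrow> ('o, 'a) endofunctor \<Rightarrow> bool" where
  "is_endofunctor C F \<longleftrightarrow>
     (\<forall>X \<in> Obj C. on_obj F X \<in> Obj C) \<and>
     (\<forall>X Y f. f \<in> Hom C X Y \<longrightarrow> on_arr F f \<in> Hom C (on_obj F X) (on_obj F Y)) \<and>
     (\<forall>X \<in> Obj C. on_arr F (Ident C X) = Ident C (on_obj F X)) \<and>
     (\<forall>X Y Z f g. f \<in> Hom C X Y \<longrightarrow> g \<in> Hom C Y Z \<longrightarrow>
        on_arr F (g \<cdot>\<^bsub>C\<^esub> f) = on_arr F g \<cdot>\<^bsub>C\<^esub> on_arr F f)"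

definition id_functor :: "('o, 'a) endofunctor" where
  "id_functor = \<lparr>on_obj = (\<lambda>X. X), on_arr = (\<lambda>f. f)\<rparr>"

definition comp_functor ::
  "('o, 'a) endofunctor \<Rightarrow> ('o, 'a) endofunctor \<Rightarrow> ('o, 'a) endofunctor" where
  "comp_functor G F = \<lparr>on_obj = on_obj G \<circ> on_obj F, on_arr = on_arr G \<circ> on_arr F\<rparr>"

definition natural_iso ::
  "('o, 'a, 'e) category_scheme \<Rightarrow> ('o, 'a) endofunctor \<Rightarrow> ('o, 'a) endofunctor
    \<Rightarrow> ('o \<Rightarrow> 'a) \<Rightarrow> bool" where
  "natural_iso C F G \<eta> \<longleftrightarrow>
     (\<forall>X \<in> Obj C. is_iso C (on_obj F X) (on_obj G X) (\<eta> X)) \<and>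
     (\<forall>X Y f. f \<in> Hom C X Y \<longrightarrow> \<eta> Y \<cdot>\<^bsub>C\<^esub> on_arr F f = on_arr G f \<cdot>\<^bsub>C\<^esub> \<eta> X)"

definition autoequivalence ::
  "('o, 'a, 'e) category_scheme \<Rightarrow> ('o, 'a) endofunctor \<Rightarrow> bool" where
  "autoequivalence C F \<longleftrightarrow> is_endofunctor C F \<and>
     (\<exists>G. is_endofunctor C G \<and>
        (\<exists>\<eta>. natural_iso C id_functor (comp_functor G F) \<eta>) \<and>
        (\<exists>\<epsilon>. natural_iso C (comp_functor F G) id_functor \<epsilon>))"


section \<open>Additive categories\<close>

record ('o, 'a) additive_category = "('o, 'a) category" +
  zero_arr :: "'o \<Rightarrow> 'o \<Rightarrow> 'a"
  add_arr :: "'a \<Rightarrow> 'a \<Rightarrow> 'a" (infixl "\<oplus>\<index>" 65)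

definition hom_group ::
  "('o, 'a, 'e) additive_category_scheme \<Rightarrow> 'o \<Rightarrow> 'o \<Rightarrow> 'a monoid" where
  "hom_group C X Y = \<lparr>carrier = Hom C X Y, mult = add_arr C, one = zero_arr C X Y\<rparr>"

definition neg_arr :: "('o, 'a, 'e) additive_category_scheme \<Rightarrow> 'a \<Rightarrow> 'a" where
  "neg_arr C f = inv\<^bsub>hom_group C (Dom C f) (Cod C f)\<^esub> f"

definition zero_object :: "('o, 'a, 'e) category_scheme \<Rightarrow> 'o \<Rightarrow> bool" where
  "zero_object C Z \<longleftrightarrow> Z \<in> Obj C \<and>
     (\<forall>X \<in> Obj C. (\<exists>!f. f \<in> Hom C X Z) \<and> (\<exists>!f. f \<in> Hom C Z X))"

definition is_biproduct ::
  "('o, 'a, 'e) additive_category_scheme \<Rightarrow> 'o \<Rightarrow> 'o \<Rightarrow> 'o \<Rightarrow> bool" where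
  "is_biproduct C X Y B \<longleftrightarrow>
     (\<exists>i \<in> Hom C X B. \<exists>j \<in> Hom C Y B. \<exists>p \<in> Hom C B X. \<exists>q \<in> Hom C B Y.
        p \<cdot>\<^bsub>C\<^esub> i = Ident C X \<and> q \<cdot>\<^bsub>C\<^esub> j = Ident C Y \<and>
        q \<cdot>\<^bsub>C\<^esub> i = zero_arr C X Y \<and> p \<cdot>\<^bsub>C\<^esub> j = zero_arr C Y X \<and>
        i \<cdot>\<^bsub>C\<^esub> p \<oplus>\<^bsub>C\<^esub> j \<cdot>\<^bsub>C\<^esub> q = Ident C B)"

locale additive_category = category C
  for C :: "('o, 'a, 'e) additive_category_scheme" (structure) +
  assumes hom_comm_group: "\<lbrakk>X \<in> Obj C; Y \<in> Obj C\<rbrakk> \<Longrightarrow> comm_group (hom_group C X Y)"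
    and Comp_add_right: "\<lbrakk>f \<in> Hom C X Y; f' \<in> Hom C X Y; g \<in> Hom C Y Z\<rbrakk>
          \<Longrightarrow> g \<cdot> (f \<oplus> f') = g \<cdot> f \<oplus> g \<cdot> f'"
    and Comp_add_left: "\<lbrakk>f \<in> Hom C X Y; g \<in> Hom C Y Z; g' \<in> Hom C Y Z\<rbrakk>
          \<Longrightarrow> (g \<oplus> g') \<cdot> f = g \<cdot> f \<oplus> g' \<cdot> f"
    and ex_zero_object: "\<exists>Z. zero_object C Z"
    and ex_biproduct: "\<lbrakk>X \<in> Obj C; Y \<in> Obj C\<rbrakk> \<Longrightarrow> \<exists>B \<in> Obj C. is_biproduct C X Y B"

definition additive_functor ::
  "('o, 'a, 'e) additive_category_scheme \<Rightarrow> ('o, 'a) endofunctor \<Rightarrow> bool" where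
  "additive_functor C F \<longleftrightarrow> is_endofunctor C F \<and>
     (\<forall>X Y f g. f \<in> Hom C X Y \<longrightarrow> g \<in> Hom C X Y \<longrightarrow>
        on_arr F (f \<oplus>\<^bsub>C\<^esub> g) = on_arr F f \<oplus>\<^bsub>C\<^esub> on_arr F g)"


section \<open>Triangulated categories\<close>

text \<open>A triangle \<open>X \<rightarrow> Y \<rightarrow> Z \<rightarrow> \<Sigma> X\<close> is recorded as the triple of its arrows. The suspension is only
  required to be an autoequivalence; an automorphism is a special case.\<close>

record ('o, 'a) triangulated_category = "('o, 'a) additive_category" +
  Shift :: "('o, 'a) endofunctor"
  Triangles :: "('a \<times> 'a \<times> 'a) set"

abbreviation shift_obj ("\<Sigma>\<^sub>o\<index>") where "shift_obj C \<equiv> on_obj (Shift C)"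
abbreviation shift_arr ("\<Sigma>\<^sub>a\<index>") where "shift_arr C \<equiv> on_arr (Shift C)"

definition is_triangle ::
  "('o, 'a, 'e) triangulated_category_scheme \<Rightarrow> 'o \<Rightarrow> 'o \<Rightarrow> 'o \<Rightarrow> 'a \<Rightarrow> 'a \<Rightarrow> 'a \<Rightarrow> bool" where
  "is_triangle C X Y Z f g h \<longleftrightarrow>
     f \<in> Hom C X Y \<and> g \<in> Hom C Y Z \<and> h \<in> Hom C Z (\<Sigma>\<^sub>o\<^bsub>C\<^esub> X)"

definition distinguished ::
  "('o, 'a, 'e) triangulated_category_scheme \<Rightarrow> 'o \<Rightarrow> 'o \<Rightarrow> 'o \<Rightarrow> 'a \<Rightarrow> 'a \<Rightarrow> 'a \<Rightarrow> bool" where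
  "distinguished C X Y Z f g h \<longleftrightarrow> is_triangle C X Y Z f g h \<and> (f, g, h) \<in> Triangles C"

locale triangulated_category = additive_category C
  for C :: "('o, 'a, 'e) triangulated_category_scheme" (structure) +
  assumes Shift_additive: "additive_functor C (Shift C)"
    and Shift_autoequivalence: "autoequivalence C (Shift C)"
    and Triangles_triangle: "(f, g, h) \<in> Triangles C \<Longrightarrow> \<exists>X Y Z. is_triangle C X Y Z f g h"
    and TR1_iso: "\<lbrakk>distinguished C X Y Z f g h; is_triangle C X' Y' Z' f' g' h';
          is_iso C X X' a; is_iso C Y Y' b; is_iso C Z Z' c;
          b \<cdot> f = f' \<cdot> a; c \<cdot> g = g' \<cdot> b; \<Sigma>\<^sub>a a \<cdot> h = h' \<cdot> c\<rbrakk>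
          \<Longrightarrow> distinguished C X' Y' Z' f' g' h'"
    and TR1_Ident: "\<lbrakk>X \<in> Obj C; zero_object C Z\<rbrakk>
          \<Longrightarrow> distinguished C X X Z (Ident C X) (zero_arr C X Z) (zero_arr C Z (\<Sigma>\<^sub>o X))"
    and TR1_cone: "f \<in> Hom C X Y \<Longrightarrow> \<exists>Z g h. distinguished C X Y Z f g h"
    and TR2: "is_triangle C X Y Z f g h \<Longrightarrow>
          distinguished C X Y Z f g h \<longleftrightarrow>
          distinguished C Y Z (\<Sigma>\<^sub>o X) g h (neg_arr C (\<Sigma>\<^sub>a f))"
    and TR3: "\<lbrakk>distinguished C X Y Z f g h; distinguished C X' Y' Z' f' g' h';
          a \<in> Hom C X X'; b \<in> Hom C Y Y'; b \<cdot> f = f' \<cdot> a\<rbrakk>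
          \<Longrightarrow> \<exists>c \<in> Hom C Z Z'. c \<cdot> g = g' \<cdot> b \<and> \<Sigma>\<^sub>a a \<cdot> h = h' \<cdot> c"
    and TR4: "\<lbrakk>distinguished C X Y Z' f u u'; distinguished C Y Z X' g v v';
          distinguished C X Z Y' (g \<cdot> f) w w'\<rbrakk>
          \<Longrightarrow> \<exists>a b. distinguished C Z' Y' X' a b (\<Sigma>\<^sub>a u \<cdot> v') \<and>
                a \<cdot> u = w \<cdot> g \<and> w' \<cdot> a = u' \<and> b \<cdot> w = v \<and> v' \<cdot> b = \<Sigma>\<^sub>a f \<cdot> w'"

definition exact_functor ::
  "('o, 'a, 'e) triangulated_category_scheme \<Rightarrow> ('o, 'a) endofunctor \<Rightarrow> bool" where
  "exact_functor C F \<longleftrightarrow> additive_functor C F \<and>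
     (\<exists>\<phi>. natural_iso C (comp_functor F (Shift C)) (comp_functor (Shift C) F) \<phi> \<and>
        (\<forall>X Y Z f g h. distinguished C X Y Z f g h \<longrightarrow>
           distinguished C (on_obj F X) (on_obj F Y) (on_obj F Z)
             (on_arr F f) (on_arr F g) (\<phi> X \<cdot>\<^bsub>C\<^esub> on_arr F h)))"


section \<open>Monoidal-triangulated categories\<close>

record ('o, 'a) monoidal_triangulated_category = "('o, 'a) triangulated_category" +
  tensor_obj :: "'o \<Rightarrow> 'o \<Rightarrow> 'o" (infixl "\<otimes>\<^sub>o\<index>" 80)
  tensor_arr :: "'a \<Rightarrow> 'a \<Rightarrow> 'a" (infixl "\<otimes>\<^sub>a\<index>" 80)
  unit_obj :: 'o
  associator :: "'o \<Rightarrow> 'o \<Rightarrow> 'o \<Rightarrow> 'a"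
  left_unitor :: "'o \<Rightarrow> 'a"
  right_unitor :: "'o \<Rightarrow> 'a"

locale monoidal_category = category K
  for K :: "('o, 'a, 'e) monoidal_triangulated_category_scheme" (structure) +
  assumes tensor_Obj: "\<lbrakk>X \<in> Obj K; Y \<in> Obj K\<rbrakk> \<Longrightarrow> X \<otimes>\<^sub>o Y \<in> Obj K"
    and tensor_Hom: "\<lbrakk>f \<in> Hom K X X'; g \<in> Hom K Y Y'\<rbrakk>
          \<Longrightarrow> f \<otimes>\<^sub>a g \<in> Hom K (X \<otimes>\<^sub>o Y) (X' \<otimes>\<^sub>o Y')"
    and tensor_Ident: "\<lbrakk>X \<in> Obj K; Y \<in> Obj K\<rbrakk>
          \<Longrightarrow> Ident K X \<otimes>\<^sub>a Ident K Y = Ident K (X \<otimes>\<^sub>o Y)"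
    and tensor_Comp: "\<lbrakk>f \<in> Hom K X X'; f' \<in> Hom K X' X''; g \<in> Hom K Y Y'; g' \<in> Hom K Y' Y''\<rbrakk>
          \<Longrightarrow> (f' \<cdot> f) \<otimes>\<^sub>a (g' \<cdot> g) = (f' \<otimes>\<^sub>a g') \<cdot> (f \<otimes>\<^sub>a g)"
    and unit_Obj: "unit_obj K \<in> Obj K"
    and associator_iso: "\<lbrakk>X \<in> Obj K; Y \<in> Obj K; Z \<in> Obj K\<rbrakk>
          \<Longrightarrow> is_iso K ((X \<otimes>\<^sub>o Y) \<otimes>\<^sub>o Z) (X \<otimes>\<^sub>o (Y \<otimes>\<^sub>o Z)) (associator K X Y Z)"
    and associator_natural: "\<lbrakk>f \<in> Hom K X X'; g \<in> Hom K Y Y'; h \<in> Hom K Z Z'\<rbrakk>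
          \<Longrightarrow> associator K X' Y' Z' \<cdot> ((f \<otimes>\<^sub>a g) \<otimes>\<^sub>a h) =
              (f \<otimes>\<^sub>a (g \<otimes>\<^sub>a h)) \<cdot> associator K X Y Z"
    and left_unitor_iso: "X \<in> Obj K \<Longrightarrow> is_iso K (unit_obj K \<otimes>\<^sub>o X) X (left_unitor K X)"
    and left_unitor_natural: "f \<in> Hom K X Y
          \<Longrightarrow> left_unitor K Y \<cdot> (Ident K (unit_obj K) \<otimes>\<^sub>a f) = f \<cdot> left_unitor K X"
    and right_unitor_iso: "X \<in> Obj K \<Longrightarrow> is_iso K (X \<otimes>\<^sub>o unit_obj K) X (right_unitor K X)"
    and right_unitor_natural: "f \<in> Hom K X Y
          \<Longrightarrow> right_unitor K Y \<cdot> (f \<otimes>\<^sub>a Ident K (unit_obj K)) = f \<cdot> right_unitor K X"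
    and pentagon: "\<lbrakk>W \<in> Obj K; X \<in> Obj K; Y \<in> Obj K; Z \<in> Obj K\<rbrakk>
          \<Longrightarrow> (Ident K W \<otimes>\<^sub>a associator K X Y Z) \<cdot> associator K W (X \<otimes>\<^sub>o Y) Z
                \<cdot> (associator K W X Y \<otimes>\<^sub>a Ident K Z) =
              associator K W X (Y \<otimes>\<^sub>o Z) \<cdot> associator K (W \<otimes>\<^sub>o X) Y Z"
    and unit_triangle: "\<lbrakk>X \<in> Obj K; Y \<in> Obj K\<rbrakk>
          \<Longrightarrow> (Ident K X \<otimes>\<^sub>a left_unitor K Y) \<cdot> associator K X (unit_obj K) Y =
              right_unitor K X \<otimes>\<^sub>a Ident K Y"

definition tensor_left ::
  "('o, 'a, 'e) monoidal_triangulated_category_scheme \<Rightarrow> 'o \<Rightarrow> ('o, 'a) endofunctor" where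
  "tensor_left K X =
     \<lparr>on_obj = (\<lambda>Y. X \<otimes>\<^sub>o\<^bsub>K\<^esub> Y), on_arr = (\<lambda>f. Ident K X \<otimes>\<^sub>a\<^bsub>K\<^esub> f)\<rparr>"

definition tensor_right ::
  "('o, 'a, 'e) monoidal_triangulated_category_scheme \<Rightarrow> 'o \<Rightarrow> ('o, 'a) endofunctor" where
  "tensor_right K X =
     \<lparr>on_obj = (\<lambda>Y. Y \<otimes>\<^sub>o\<^bsub>K\<^esub> X), on_arr = (\<lambda>f. f \<otimes>\<^sub>a\<^bsub>K\<^esub> Ident K X)\<rparr>"

locale monoidal_triangulated_category = triangulated_category K + monoidal_category K
  for K :: "('o, 'a, 'e) monoidal_triangulated_category_scheme" (structure) +
  assumes tensor_left_exact: "X \<in> Obj K \<Longrightarrow> exact_functor K (tensor_left K X)"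
    and tensor_right_exact: "X \<in> Obj K \<Longrightarrow> exact_functor K (tensor_right K X)"


section \<open>Thick, prime and semiprime tensor ideals\<close>

text \<open>Full subcategories are given by their sets of objects.\<close>

definition triangulated_subcategory ::
  "('o, 'a, 'e) triangulated_category_scheme \<Rightarrow> 'o set \<Rightarrow> bool" where
  "triangulated_subcategory C I \<longleftrightarrow> I \<subseteq> Obj C \<and> I \<noteq> {} \<and>
     (\<forall>X Y. X \<in> I \<longrightarrow> isomorphic C X Y \<longrightarrow> Y \<in> I) \<and>
     (\<forall>X \<in> Obj C. X \<in> I \<longleftrightarrow> \<Sigma>\<^sub>o\<^bsub>C\<^esub> X \<in> I) \<and>
     (\<forall>X Y Z f g h. distinguished C X Y Z f g h \<longrightarrow> X \<in> I \<longrightarrow> Y \<in> I \<longrightarrow> Z \<in> I)"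

definition thick_subcategory ::
  "('o, 'a, 'e) triangulated_category_scheme \<Rightarrow> 'o set \<Rightarrow> bool" where
  "thick_subcategory C I \<longleftrightarrow> triangulated_subcategory C I \<and>
     (\<forall>X Y B. is_biproduct C X Y B \<longrightarrow> B \<in> I \<longrightarrow> X \<in> I \<and> Y \<in> I)"

definition thick_ideal ::
  "('o, 'a, 'e) monoidal_triangulated_category_scheme \<Rightarrow> 'o set \<Rightarrow> bool" where
  "thick_ideal K I \<longleftrightarrow> thick_subcategory K I \<and>
     (\<forall>X \<in> I. \<forall>Y \<in> Obj K. X \<otimes>\<^sub>o\<^bsub>K\<^esub> Y \<in> I \<and> Y \<otimes>\<^sub>o\<^bsub>K\<^esub> X \<in> I)"

definition prime_ideal ::
  "('o, 'a, 'e) monoidal_triangulated_category_scheme \<Rightarrow> 'o set \<Rightarrow> bool" where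
  "prime_ideal K P \<longleftrightarrow> thick_ideal K P \<and> P \<noteq> Obj K \<and>
     (\<forall>I J. thick_ideal K I \<longrightarrow> thick_ideal K J \<longrightarrow>
        {X \<otimes>\<^sub>o\<^bsub>K\<^esub> Y |X Y. X \<in> I \<and> Y \<in> J} \<subseteq> P \<longrightarrow> I \<subseteq> P \<or> J \<subseteq> P)"

text \<open>Intersecting with \<^term>\<open>Obj K\<close> makes the whole category the empty intersection.\<close>

definition semiprime_ideal ::
  "('o, 'a, 'e) monoidal_triangulated_category_scheme \<Rightarrow> 'o set \<Rightarrow> bool" where
  "semiprime_ideal K I \<longleftrightarrow> thick_ideal K I \<and>
     (\<exists>\<P>. (\<forall>P \<in> \<P>. prime_ideal K P) \<and> I = Obj K \<inter> \<Inter>\<P>)"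

text \<open>The smallest semiprime thick ideal containing \<open>S\<close>, for \<open>S \<subseteq> Obj K\<close>.\<close>

definition semiprime_hull ::
  "('o, 'a, 'e) monoidal_triangulated_category_scheme \<Rightarrow> 'o set \<Rightarrow> 'o set" where
  "semiprime_hull K S = \<Inter>{I. semiprime_ideal K I \<and> S \<subseteq> I}"

definition semiprime_lattice ::
  "('o, 'a, 'e) monoidal_triangulated_category_scheme \<Rightarrow> 'o set gorder" where
  "semiprime_lattice K =
     \<lparr>carrier = {I. semiprime_ideal K I}, eq = (=), le = (\<subseteq>)\<rparr>"

definition compact_element :: "('b, 'e) gorder_scheme \<Rightarrow> 'b \<Rightarrow> bool" where
  "compact_element L c \<longleftrightarrow> c \<in> carrier L \<and>
     (\<forall>S. S \<subseteq> carrier L \<longrightarrow> c \<sqsubseteq>\<^bsub>L\<^esub> \<Squnion>\<^bsub>L\<^esub> S \<longrightarrow>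
        (\<exists>S'. S' \<subseteq> S \<and> finite S' \<and> c \<sqsubseteq>\<^bsub>L\<^esub> \<Squnion>\<^bsub>L\<^esub> S'))"

definition compact_detection ::
  "('o, 'a, 'e) monoidal_triangulated_category_scheme \<Rightarrow> bool" where
  "compact_detection K \<longleftrightarrow>
     (\<forall>x \<in> Obj K. \<exists>s \<in> Obj K. \<forall>I. semiprime_ideal K I \<longrightarrow>
        (x \<in> I \<longleftrightarrow> x \<otimes>\<^sub>o\<^bsub>K\<^esub> s \<otimes>\<^sub>o\<^bsub>K\<^esub> x \<in> I))"


section \<open>The lattice of semiprime ideals\<close>

context monoidal_triangulated_category
begin

lemma isomorphic_Obj: "isomorphic K X Y \<Longrightarrow> Y \<in> Obj K"
  using Cod_Obj by (auto simp: isomorphic_def is_iso_def Hom_def)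

lemma Shift_Obj: "X \<in> Obj K \<Longrightarrow> \<Sigma>\<^sub>o X \<in> Obj K"
  using Shift_additive by (simp add: additive_functor_def is_endofunctor_def)

lemmas thick_ideal_unfold =
  thick_ideal_def thick_subcategory_def triangulated_subcategory_def

lemma thick_ideal_Obj: "thick_ideal K (Obj K)"
  unfolding thick_ideal_unfold
proof (intro conjI allI impI ballI)
  show "Obj K \<noteq> {}" using unit_Obj by blast
  fix X Y Z f g h assume "distinguished K X Y Z f g h"
  then have "g \<in> Hom K Y Z" by (simp add: distinguished_def is_triangle_def)
  then show "Z \<in> Obj K" using Cod_Obj by (auto simp: Hom_def)
next
  fix X Y B assume "is_biproduct K X Y B"
  then obtain i j where "i \<in> Hom K X B" "j \<in> Hom K Y B"
    unfolding is_biproduct_def by (elim bexE)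
  then show "X \<in> Obj K" "Y \<in> Obj K" using Dom_Obj by (auto simp: Hom_def)
qed (auto intro: isomorphic_Obj Shift_Obj tensor_Obj)

lemma thick_ideal_dest:
  assumes "thick_ideal K I"
  shows thick_ideal_subset: "I \<subseteq> Obj K"
    and thick_ideal_nonempty: "I \<noteq> {}"
    and thick_ideal_isomorphic: "X \<in> I \<Longrightarrow> isomorphic K X Y \<Longrightarrow> Y \<in> I"
    and thick_ideal_shift: "X \<in> Obj K \<Longrightarrow> X \<in> I \<longleftrightarrow> \<Sigma>\<^sub>o X \<in> I"
    and thick_ideal_cone: "distinguished K X Y Z f g h \<Longrightarrow> X \<in> I \<Longrightarrow> Y \<in> I \<Longrightarrow> Z \<in> I"
    and thick_ideal_summand: "is_biproduct K X Y B \<Longrightarrow> B \<in> I \<Longrightarrow> X \<in> I \<and> Y \<in> I"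
    and thick_ideal_tensor: "X \<in> I \<Longrightarrow> Y \<in> Obj K \<Longrightarrow> X \<otimes>\<^sub>o Y \<in> I \<and> Y \<otimes>\<^sub>o X \<in> I"
proof -
  note I = assms[unfolded thick_ideal_unfold]
  show "I \<subseteq> Obj K" "I \<noteq> {}"
    using I by simp_all
  show "Y \<in> I" if "X \<in> I" "isomorphic K X Y"
    using I that by simp
  show "X \<in> I \<longleftrightarrow> \<Sigma>\<^sub>o X \<in> I" if "X \<in> Obj K"
    using I that by simp
  have "\<forall>X Y Z f g h. distinguished K X Y Z f g h \<longrightarrow> X \<in> I \<longrightarrow> Y \<in> I \<longrightarrow> Z \<in> I"
    using I by (elim conjE)
  then show "Z \<in> I" if "distinguished K X Y Z f g h" "X \<in> I" "Y \<in> I"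
    using that by (elim allE impE)
  have "\<forall>X Y B. is_biproduct K X Y B \<longrightarrow> B \<in> I \<longrightarrow> X \<in> I \<and> Y \<in> I"
    using I by (elim conjE)
  then show "X \<in> I \<and> Y \<in> I" if "is_biproduct K X Y B" "B \<in> I"
    using that by (elim allE impE)
  show "X \<otimes>\<^sub>o Y \<in> I \<and> Y \<otimes>\<^sub>o X \<in> I" if "X \<in> I" "Y \<in> Obj K"
    using I that by simp
qed

lemma zero_object_thick:
  assumes I: "thick_ideal K I" and Z: "zero_object K Z"
  shows "Z \<in> I"
proof -
  obtain X where X: "X \<in> I" using thick_ideal_nonempty[OF I] by blast
  then have "X \<in> Obj K" using thick_ideal_subset[OF I] by blast
  then show ?thesis using thick_ideal_cone[OF I TR1_Ident[OF _ Z]] X by blast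
qed

lemma thick_ideal_Inter:
  assumes "\<And>I. I \<in> \<I> \<Longrightarrow> thick_ideal K I"
  shows "thick_ideal K (Obj K \<inter> \<Inter>\<I>)"
proof -
  define \<J> where "\<J> = insert (Obj K) \<I>"
  have J: "thick_ideal K I" if "I \<in> \<J>" for I
    using that assms thick_ideal_Obj unfolding \<J>_def by blast
  have eq: "Obj K \<inter> \<Inter>\<I> = \<Inter>\<J>" and sub: "\<Inter>\<J> \<subseteq> Obj K"
    unfolding \<J>_def by auto
  obtain Z where Z: "zero_object K Z" using ex_zero_object by blast
  show ?thesis
    unfolding eq thick_ideal_unfold
  proof (intro conjI allI impI ballI)
    show "\<Inter>\<J> \<subseteq> Obj K" by (rule sub)
    show "\<Inter>\<J> \<noteq> {}" using zero_object_thick[OF J Z] by blast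
  next
    fix X Y assume "X \<in> \<Inter>\<J>" "isomorphic K X Y"
    then show "Y \<in> \<Inter>\<J>" using thick_ideal_isomorphic[OF J, of _ X Y] by simp
  next
    fix X assume "X \<in> Obj K"
    then show "X \<in> \<Inter>\<J> \<longleftrightarrow> \<Sigma>\<^sub>o X \<in> \<Inter>\<J>" using thick_ideal_shift[OF J, of _ X] by simp
  next
    fix X Y Z f g h assume "distinguished K X Y Z f g h" "X \<in> \<Inter>\<J>" "Y \<in> \<Inter>\<J>"
    then show "Z \<in> \<Inter>\<J>" using thick_ideal_cone[OF J, of _ X Y Z f g h] by simp
  next
    fix X Y B assume "is_biproduct K X Y B" "B \<in> \<Inter>\<J>"
    then show "X \<in> \<Inter>\<J>" "Y \<in> \<Inter>\<J>" using thick_ideal_summand[OF J, of _ X Y B] by simp_all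
  next
    fix X Y assume "X \<in> \<Inter>\<J>" "Y \<in> Obj K"
    then show "X \<otimes>\<^sub>o Y \<in> \<Inter>\<J>" "Y \<otimes>\<^sub>o X \<in> \<Inter>\<J>" using thick_ideal_tensor[OF J, of _ X Y] by simp_all
  qed
qed

lemma semiprime_ideal_Inter:
  assumes "\<And>I. I \<in> \<I> \<Longrightarrow> semiprime_ideal K I"
  shows "semiprime_ideal K (Obj K \<inter> \<Inter>\<I>)"
proof -
  define \<P> where "\<P> = {P. prime_ideal K P \<and> (\<exists>I \<in> \<I>. I \<subseteq> P)}"
  have "Obj K \<inter> \<Inter>\<P> \<subseteq> I" if "I \<in> \<I>" for I
  proof -
    obtain \<Q> where Q: "\<forall>P \<in> \<Q>. prime_ideal K P" "I = Obj K \<inter> \<Inter>\<Q>"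
      using assms \<open>I \<in> \<I>\<close> unfolding semiprime_ideal_def by blast
    then have "\<Q> \<subseteq> \<P>" using \<open>I \<in> \<I>\<close> unfolding \<P>_def by blast
    then show ?thesis using Q by blast
  qed
  then have "Obj K \<inter> \<Inter>\<I> = Obj K \<inter> \<Inter>\<P>" unfolding \<P>_def by blast
  moreover have "\<forall>P \<in> \<P>. prime_ideal K P" unfolding \<P>_def by blast
  moreover have "thick_ideal K (Obj K \<inter> \<Inter>\<I>)"
    using assms unfolding semiprime_ideal_def by (intro thick_ideal_Inter) blast
  ultimately show ?thesis unfolding semiprime_ideal_def by blast
qed

lemma semiprime_ideal_Obj: "semiprime_ideal K (Obj K)"
  using semiprime_ideal_Inter[of "{}"] by simp

lemma semiprime_ideal_subset: "semiprime_ideal K I \<Longrightarrow> I \<subseteq> Obj K"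
  unfolding semiprime_ideal_def by blast

lemma semiprime_hull:
  assumes "S \<subseteq> Obj K"
  shows "semiprime_ideal K (semiprime_hull K S)" "S \<subseteq> semiprime_hull K S"
    and "\<And>I. semiprime_ideal K I \<Longrightarrow> S \<subseteq> I \<Longrightarrow> semiprime_hull K S \<subseteq> I"
proof -
  have "semiprime_hull K S = Obj K \<inter> \<Inter>{I. semiprime_ideal K I \<and> S \<subseteq> I}"
    using assms semiprime_ideal_Obj unfolding semiprime_hull_def by blast
  then show "semiprime_ideal K (semiprime_hull K S)"
    using semiprime_ideal_Inter[of "{I. semiprime_ideal K I \<and> S \<subseteq> I}"] by simp
qed (unfold semiprime_hull_def, blast+)

lemma partial_order_semiprime: "partial_order (semiprime_lattice K)"
  by unfold_locales (auto simp: semiprime_lattice_def)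

lemma least_semiprime_hull:
  assumes "\<I> \<subseteq> carrier (semiprime_lattice K)"
  shows "least (semiprime_lattice K) (semiprime_hull K (\<Union>\<I>)) (Upper (semiprime_lattice K) \<I>)"
proof -
  have "\<Union>\<I> \<subseteq> Obj K"
    using assms semiprime_ideal_subset unfolding semiprime_lattice_def by auto
  note hull = semiprime_hull[OF this]
  show ?thesis
    unfolding least_def
  proof (intro conjI ballI)
    show "Upper (semiprime_lattice K) \<I> \<subseteq> carrier (semiprime_lattice K)"
      by (rule Upper_closed)
    show "semiprime_hull K (\<Union>\<I>) \<in> Upper (semiprime_lattice K) \<I>"
      using hull(1,2) by (auto simp: Upper_def semiprime_lattice_def)
    fix J assume "J \<in> Upper (semiprime_lattice K) \<I>"
    then have "semiprime_ideal K J" "\<Union>\<I> \<subseteq> J"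
      using assms by (auto simp: Upper_def semiprime_lattice_def)
    then show "semiprime_hull K (\<Union>\<I>) \<sqsubseteq>\<^bsub>semiprime_lattice K\<^esub> J"
      using hull(3) by (simp add: semiprime_lattice_def)
  qed
qed

text \<open>The joins provided by the library are the semiprime hulls of unions.\<close>

lemma sup_semiprime_lattice:
  assumes "\<I> \<subseteq> carrier (semiprime_lattice K)"
  shows "\<Squnion>\<^bsub>semiprime_lattice K\<^esub> \<I> = semiprime_hull K (\<Union>\<I>)"
proof -
  interpret L: partial_order "semiprime_lattice K" by (rule partial_order_semiprime)
  show ?thesis unfolding sup_def
    using least_semiprime_hull[OF assms] L.least_unique by (metis (lifting) someI_ex)
qed

lemma complete_lattice_semiprime: "complete_lattice (semiprime_lattice K)"
proof (rule partial_order.complete_latticeI[OF partial_order_semiprime])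
  fix \<I> assume A: "\<I> \<subseteq> carrier (semiprime_lattice K)"
  show "\<exists>s. least (semiprime_lattice K) s (Upper (semiprime_lattice K) \<I>)"
    by (rule exI, rule least_semiprime_hull[OF A])
  have "semiprime_ideal K (Obj K \<inter> \<Inter>\<I>)"
    using A by (intro semiprime_ideal_Inter) (auto simp: semiprime_lattice_def)
  then have inf: "Obj K \<inter> \<Inter>\<I> \<in> Lower (semiprime_lattice K) \<I>"
    by (auto simp: Lower_def semiprime_lattice_def)
  have "greatest (semiprime_lattice K) (Obj K \<inter> \<Inter>\<I>) (Lower (semiprime_lattice K) \<I>)"
    unfolding greatest_def
  proof (intro conjI ballI inf)
    show "Lower (semiprime_lattice K) \<I> \<subseteq> carrier (semiprime_lattice K)"
      by (rule Lower_closed)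
    fix J assume "J \<in> Lower (semiprime_lattice K) \<I>"
    then have "semiprime_ideal K J" and J: "\<forall>I \<in> \<I>. J \<subseteq> I"
      using A by (auto simp: Lower_def semiprime_lattice_def)
    then have "J \<subseteq> Obj K" by (intro semiprime_ideal_subset)
    with J show "J \<sqsubseteq>\<^bsub>semiprime_lattice K\<^esub> Obj K \<inter> \<Inter>\<I>"
      by (simp add: semiprime_lattice_def Inf_greatest)
  qed
  then show "\<exists>i. greatest (semiprime_lattice K) i (Lower (semiprime_lattice K) \<I>)" by (rule exI)
qed

end

end

(* Compact elements are always principal, since a finite set of objects can be replaced by its direct
   sum. For the rest, the point is that a thick ideal I is semiprime iff x \<otimes> y \<otimes> x \<in> I for all y implies
   x \<in> I (an m-system argument). Compact detection bounds the quantifier over y by a single object s, and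
   this makes directed unions of semiprime ideals semiprime, which is compactness of the principal
   ideals. Conversely, x lies in the join of the ideals generated by the x \<otimes> y \<otimes> x, so by compactness
   finitely many y suffice, and their direct sum is the detecting object s. *)

theory Submission
  imports Defs
begin

section \<open>Additive categories\<close>

text \<open>The thick ideal generated by a set has no usable elementwise description, since cones
  and summands intervene at every stage. The classical step of an m-system argument, in which the
  ideals generated by P and J1 and by P and J2 both meet the system, therefore cannot be computed
  with generators. Residuals replace them: J2 is enlarged to the objects that J1 multiplies into P,
  then J1 to the objects that multiply all of these into P, always with an arbitrary middle factor.
  Exactness of tensoring makes such sets thick.

  Exactness also explains the direct sums: for fixed x, the objects y with x \<otimes> y \<otimes> x
  in a given ideal form a thick subcategory. Thickness provides shifts, cones and summands, so
  closure under sums has to be extracted from the triangle of a split injection.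

  The obstacle to compactness is a moving witness: in a directed union, each x \<otimes> y \<otimes>
  x may lie in a member that depends on y, and no member need contain all of them. With one test
  object, a single member decides.\<close>

lemma HomD:
  assumes "f \<in> Hom C X Y"
  shows "f \<in> Arr C" "Dom C f = X" "Cod C f = Y"
  using assms by (auto simp: Hom_def)

context category
begin

lemma Hom_Obj:
  assumes "f \<in> Hom C X Y"
  shows "X \<in> Obj C" "Y \<in> Obj C"
  using assms Dom_Obj Cod_Obj by (auto simp: Hom_def)

lemma isomorphic_sym: "isomorphic C X Y \<Longrightarrow> isomorphic C Y X"
  unfolding isomorphic_def is_iso_def by blast

lemma isomorphic_functor:
  assumes F: "is_endofunctor C F" and "isomorphic C X Y"
  shows "isomorphic C (on_obj F X) (on_obj F Y)"
proof -
  obtain f g where f: "f \<in> Hom C X Y" and g: "g \<in> Hom C Y X"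
    and gf: "g \<cdot> f = Ident C X" and fg: "f \<cdot> g = Ident C Y"
    using assms(2) unfolding isomorphic_def is_iso_def by blast
  have "on_arr F g \<cdot> on_arr F f = Ident C (on_obj F X)"
    using F f g gf Hom_Obj[OF f] unfolding is_endofunctor_def by metis
  moreover have "on_arr F f \<cdot> on_arr F g = Ident C (on_obj F Y)"
    using F f g fg Hom_Obj[OF f] unfolding is_endofunctor_def by metis
  moreover have "on_arr F f \<in> Hom C (on_obj F X) (on_obj F Y)"
    "on_arr F g \<in> Hom C (on_obj F Y) (on_obj F X)"
    using F f g unfolding is_endofunctor_def by blast+
  ultimately show ?thesis unfolding isomorphic_def is_iso_def by blast
qed

end

section \<open>Zero arrows, zero objects and biproducts under additive functors\<close>

context additive_category
begin

lemma zero_arr_Hom: "\<lbrakk>X \<in> Obj C; Y \<in> Obj C\<rbrakk> \<Longrightarrow> zero_arr C X Y \<in> Hom C X Y"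
  using comm_group.axioms(2)[OF hom_comm_group, THEN group.is_monoid, THEN monoid.one_closed]
  by (simp add: hom_group_def)

lemma add_zero:
  assumes "f \<in> Hom C X Y"
  shows "f \<oplus> zero_arr C X Y = f" "zero_arr C X Y \<oplus> f = f"
proof -
  interpret G: comm_group "hom_group C X Y"
    using hom_comm_group Hom_Obj[OF assms] by blast
  show "f \<oplus> zero_arr C X Y = f" "zero_arr C X Y \<oplus> f = f"
    using assms G.r_one[of f] G.l_one[of f] by (simp_all add: hom_group_def)
qed

lemma add_Hom:
  assumes "f \<in> Hom C X Y" "g \<in> Hom C X Y"
  shows "f \<oplus> g \<in> Hom C X Y"
proof -
  interpret G: comm_group "hom_group C X Y"
    using hom_comm_group Hom_Obj[OF assms(1)] by blast
  show ?thesis using assms G.m_closed[of f g] by (simp add: hom_group_def)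
qed

lemma neg_Hom:
  assumes "f \<in> Hom C X Y"
  shows "neg_arr C f \<in> Hom C X Y"
proof -
  interpret G: comm_group "hom_group C X Y"
    using hom_comm_group Hom_Obj[OF assms] by blast
  show ?thesis using assms G.inv_closed[of f] HomD[OF assms] by (simp add: hom_group_def neg_arr_def)
qed

lemma add_neg:
  assumes "f \<in> Hom C X Y"
  shows "f \<oplus> neg_arr C f = zero_arr C X Y"
proof -
  interpret G: comm_group "hom_group C X Y"
    using hom_comm_group Hom_Obj[OF assms] by blast
  show ?thesis using assms G.r_inv[of f] HomD[OF assms] by (simp add: hom_group_def neg_arr_def)
qed

lemma add_right_cancel:
  assumes "f \<in> Hom C X Y" "g \<in> Hom C X Y" "h \<in> Hom C X Y" "f \<oplus> h = g \<oplus> h"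
  shows "f = g"
proof -
  interpret G: comm_group "hom_group C X Y"
    using hom_comm_group Hom_Obj[OF assms(1)] by blast
  show ?thesis using assms G.right_cancel[of h f g] by (simp add: hom_group_def)
qed

text \<open>A group has no idempotent besides its neutral element. Additivity alone thus makes
  composition with zero arrows and the image of a zero arrow under an additive functor
  vanish.\<close>

lemma add_idem_zero:
  assumes "f \<in> Hom C X Y" "f \<oplus> f = f"
  shows "f = zero_arr C X Y"
  using assms add_right_cancel[OF assms(1) zero_arr_Hom assms(1)] Hom_Obj[OF assms(1)]
  by (simp add: add_zero)

lemma Comp_zero:
  assumes g: "g \<in> Hom C Y Z" and X: "X \<in> Obj C"
  shows "g \<cdot> zero_arr C X Y = zero_arr C X Z"
proof -
  have z: "zero_arr C X Y \<in> Hom C X Y" using zero_arr_Hom X Hom_Obj[OF g] by blast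
  show ?thesis
    using add_idem_zero[OF Comp_Hom[OF z g]] Comp_add_right[OF z z g] add_zero(1)[OF z] by simp
qed

lemma zero_Comp:
  assumes f: "f \<in> Hom C X Y" and Z: "Z \<in> Obj C"
  shows "zero_arr C Y Z \<cdot> f = zero_arr C X Z"
proof -
  have z: "zero_arr C Y Z \<in> Hom C Y Z" using zero_arr_Hom Z Hom_Obj[OF f] by blast
  show ?thesis
    using add_idem_zero[OF Comp_Hom[OF f z]] Comp_add_left[OF f z z] add_zero(1)[OF z] by simp
qed

lemma additive_functor_zero:
  assumes F: "additive_functor C F" and "X \<in> Obj C" "Y \<in> Obj C"
  shows "on_arr F (zero_arr C X Y) = zero_arr C (on_obj F X) (on_obj F Y)"
proof -
  have z: "zero_arr C X Y \<in> Hom C X Y" using zero_arr_Hom assms by blast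
  then have "on_arr F (zero_arr C X Y) \<in> Hom C (on_obj F X) (on_obj F Y)"
    using F unfolding additive_functor_def is_endofunctor_def by blast
  moreover have "on_arr F (zero_arr C X Y) \<oplus> on_arr F (zero_arr C X Y) = on_arr F (zero_arr C X Y)"
    using F z add_zero(1)[OF z] unfolding additive_functor_def by metis
  ultimately show ?thesis by (rule add_idem_zero)
qed

text \<open>Every arrow into or out of \<open>Z\<close> is unchanged by composing with
  \<open>Ident C Z\<close>, so it vanishes once this identity does. The equational form passes
  through additive functors.\<close>

lemma zero_object_iff:
  "zero_object C Z \<longleftrightarrow> Z \<in> Obj C \<and> Ident C Z = zero_arr C Z Z"
proof
  assume "zero_object C Z"
  then show "Z \<in> Obj C \<and> Ident C Z = zero_arr C Z Z"
    unfolding zero_object_def using Ident_Hom zero_arr_Hom by blast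
next
  assume Z: "Z \<in> Obj C \<and> Ident C Z = zero_arr C Z Z"
  have to: "f = zero_arr C X Z" if "f \<in> Hom C X Z" for f X
    using Ident_Comp[OF that] zero_Comp[OF that, of Z] Z by simp
  have from_zero: "f = zero_arr C Z X" if "f \<in> Hom C Z X" for f X
    using Comp_Ident[OF that] Comp_zero[OF that, of Z] Z by simp
  show "zero_object C Z"
    unfolding zero_object_def using Z to from_zero zero_arr_Hom by blast
qed

lemma zero_object_Hom_from:
  assumes "zero_object C Z" "f \<in> Hom C Z X"
  shows "f = zero_arr C Z X"
  using assms Hom_Obj[of f Z X] zero_arr_Hom[of Z X] unfolding zero_object_def by blast

lemma zero_object_functor:
  assumes "additive_functor C F" "zero_object C Z"
  shows "zero_object C (on_obj F Z)"
  using assms additive_functor_zero[OF assms(1), of Z Z]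
  unfolding zero_object_iff additive_functor_def is_endofunctor_def by metis

lemma is_biproduct_functor:
  assumes F: "additive_functor C F" and B: "is_biproduct C X Y B"
  shows "is_biproduct C (on_obj F X) (on_obj F Y) (on_obj F B)"
proof -
  from B obtain i j p q where h: "i \<in> Hom C X B" "j \<in> Hom C Y B" "p \<in> Hom C B X" "q \<in> Hom C B Y"
    and e: "p \<cdot> i = Ident C X" "q \<cdot> j = Ident C Y"
      "q \<cdot> i = zero_arr C X Y" "p \<cdot> j = zero_arr C Y X" "i \<cdot> p \<oplus> j \<cdot> q = Ident C B"
    unfolding is_biproduct_def by blast
  have O: "X \<in> Obj C" "Y \<in> Obj C" "B \<in> Obj C" using Hom_Obj h by blast+
  have FH: "\<And>X Y f. f \<in> Hom C X Y \<Longrightarrow> on_arr F f \<in> Hom C (on_obj F X) (on_obj F Y)"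
    and FC: "\<And>X Y Z f g. f \<in> Hom C X Y \<Longrightarrow> g \<in> Hom C Y Z \<Longrightarrow>
        on_arr F (g \<cdot> f) = on_arr F g \<cdot> on_arr F f"
    and FI: "\<And>X. X \<in> Obj C \<Longrightarrow> on_arr F (Ident C X) = Ident C (on_obj F X)"
    and FA: "\<And>X Y f g. f \<in> Hom C X Y \<Longrightarrow> g \<in> Hom C X Y \<Longrightarrow>
        on_arr F (f \<oplus> g) = on_arr F f \<oplus> on_arr F g"
    using F unfolding additive_functor_def is_endofunctor_def by blast+
  have "on_arr F i \<cdot> on_arr F p \<oplus> on_arr F j \<cdot> on_arr F q = Ident C (on_obj F B)"
    using FA[OF Comp_Hom[OF h(3,1)] Comp_Hom[OF h(4,2)]] FC[OF h(3,1)] FC[OF h(4,2)] e(5) FI[OF O(3)]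
    by simp
  moreover have "on_arr F p \<cdot> on_arr F i = Ident C (on_obj F X)"
    "on_arr F q \<cdot> on_arr F j = Ident C (on_obj F Y)"
    "on_arr F q \<cdot> on_arr F i = zero_arr C (on_obj F X) (on_obj F Y)"
    "on_arr F p \<cdot> on_arr F j = zero_arr C (on_obj F Y) (on_obj F X)"
    using FC[OF h(1,3)] FC[OF h(2,4)] FC[OF h(1,4)] FC[OF h(2,3)] e FI O
      additive_functor_zero[OF F] by simp_all
  ultimately show ?thesis
    unfolding is_biproduct_def using FH[OF h(1)] FH[OF h(2)] FH[OF h(3)] FH[OF h(4)] by blast
qed

end


section \<open>Thick subcategories\<close>

context triangulated_category
begin

section \<open>Triangle calculus up to the cone of a biproduct injection\<close>

lemma Shift_functor: "is_endofunctor C (Shift C)"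
  using Shift_additive by (simp add: additive_functor_def)

lemma Shift_Hom: "f \<in> Hom C X Y \<Longrightarrow> \<Sigma>\<^sub>a f \<in> Hom C (\<Sigma>\<^sub>o X) (\<Sigma>\<^sub>o Y)"
  using Shift_functor unfolding is_endofunctor_def by blast

lemma distinguished_Hom:
  assumes "distinguished C X Y Z f g h"
  shows "f \<in> Hom C X Y" "g \<in> Hom C Y Z" "h \<in> Hom C Z (\<Sigma>\<^sub>o X)"
  using assms unfolding distinguished_def is_triangle_def by blast+

lemma distinguished_rotate:
  assumes "distinguished C X Y Z f g h"
  shows "distinguished C Y Z (\<Sigma>\<^sub>o X) g h (neg_arr C (\<Sigma>\<^sub>a f))"
  using assms TR2[of X Y Z f g h] unfolding distinguished_def by blast

text \<open>TR3 maps the triangle on the identity of \<open>X\<close> to the given one by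
  \<open>Ident C X\<close> and \<open>f\<close>; its third vertex is a zero object, through which
  \<open>g \<cdot> f\<close> then factors.\<close>

lemma distinguished_comp_zero:
  assumes d: "distinguished C X Y Z f g h"
  shows "g \<cdot> f = zero_arr C X Z"
proof -
  note H = distinguished_Hom[OF d]
  note O = Hom_Obj[OF H(1)] Hom_Obj[OF H(2)]
  obtain W where W: "zero_object C W" using ex_zero_object by blast
  have "f \<cdot> Ident C X = f \<cdot> Ident C X" ..
  then obtain c where c: "c \<in> Hom C W Z" "c \<cdot> zero_arr C X W = g \<cdot> f"
    using TR3[OF TR1_Ident[OF O(1) W] d Ident_Hom[OF O(1)] H(1)] by blast
  then show ?thesis using Comp_zero[OF c(1) O(1)] by simp
qed

text \<open>The factorization is the third component of a morphism, given by TR3, into the triangle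
  \<open>N \<rightarrow> W \<rightarrow> W\<close> with \<open>N\<close> a zero object. The
  condition on \<open>u \<cdot> f\<close> is the commuting square that TR3 asks for.\<close>

lemma distinguished_weak_cokernel:
  assumes d: "distinguished C X Y Z f g h" and u: "u \<in> Hom C Y W" and uf: "u \<cdot> f = zero_arr C X W"
  shows "\<exists>r \<in> Hom C Z W. r \<cdot> g = u"
proof -
  note H = distinguished_Hom[OF d]
  note O = Hom_Obj[OF H(1)] Hom_Obj[OF H(2)] Hom_Obj[OF u]
  obtain N where N: "zero_object C N" using ex_zero_object by blast
  then have NO: "N \<in> Obj C" unfolding zero_object_def by blast
  have SN: "zero_object C (\<Sigma>\<^sub>o N)" by (rule zero_object_functor[OF Shift_additive N])
  then have SNO: "\<Sigma>\<^sub>o N \<in> Obj C" unfolding zero_object_def by blast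
  have WO: "W \<in> Obj C" using O by blast
  let ?f = "zero_arr C N W" and ?h = "zero_arr C W (\<Sigma>\<^sub>o N)"
  have fH: "?f \<in> Hom C N W" using zero_arr_Hom NO WO by blast
  have t: "is_triangle C N W W ?f (Ident C W) ?h"
    unfolding is_triangle_def using fH Ident_Hom zero_arr_Hom WO SNO by blast
  \<comment> \<open>Rotating the desired triangle gives the identity triangle of \<open>W\<close> up
    to the sign introduced by TR2. The sign is harmless because all arrows from a zero object to a
    given target agree.\<close>
  have "neg_arr C (\<Sigma>\<^sub>a ?f) = zero_arr C (\<Sigma>\<^sub>o N) (\<Sigma>\<^sub>o W)"
    using zero_object_Hom_from[OF SN] neg_Hom[OF Shift_Hom[OF fH]] by blast
  then have N': "distinguished C N W W ?f (Ident C W) ?h"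
    using TR2[OF t] TR1_Ident[OF WO SN] by simp
  have a: "zero_arr C X N \<in> Hom C X N" using zero_arr_Hom O NO by blast
  have "u \<cdot> f = ?f \<cdot> zero_arr C X N" using uf Comp_zero[OF fH] O by simp
  from TR3[OF d N' a u this] obtain c where "c \<in> Hom C Z W" "c \<cdot> g = Ident C W \<cdot> u"
    by blast
  then show ?thesis using Ident_Comp[OF u] by auto
qed

text \<open>The injection \<open>i\<close> is split, so the connecting arrow \<open>h\<close> vanishes and \<open>g\<close> is an epimorphism;
  hence \<open>g \<cdot> j\<close> is invertible, its inverse being induced by \<open>q\<close>.\<close>

lemma cone_biproduct_injection:
  assumes B: "is_biproduct C X Y B"
  obtains Z f g h where "distinguished C X B Z f g h" "isomorphic C Y Z"
proof -
  from B obtain i j p q where H: "i \<in> Hom C X B" "j \<in> Hom C Y B" "p \<in> Hom C B X" "q \<in> Hom C B Y"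
    and e: "p \<cdot> i = Ident C X" "q \<cdot> j = Ident C Y"
      "q \<cdot> i = zero_arr C X Y" "p \<cdot> j = zero_arr C Y X" "i \<cdot> p \<oplus> j \<cdot> q = Ident C B"
    unfolding is_biproduct_def by blast
  obtain Z g h where d: "distinguished C X B Z i g h" using TR1_cone[OF H(1)] by blast
  have g: "g \<in> Hom C B Z" and h: "h \<in> Hom C Z (\<Sigma>\<^sub>o X)" using distinguished_Hom[OF d] by blast+
  have O: "X \<in> Obj C" "Y \<in> Obj C" "B \<in> Obj C" "Z \<in> Obj C" "\<Sigma>\<^sub>o X \<in> Obj C" "\<Sigma>\<^sub>o B \<in> Obj C"
    using Hom_Obj H g h Hom_Obj[OF Shift_Hom[OF H(1)]] by blast+
  note d' = distinguished_rotate[OF d]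
  have Si: "\<Sigma>\<^sub>a i \<in> Hom C (\<Sigma>\<^sub>o X) (\<Sigma>\<^sub>o B)" and Sp: "\<Sigma>\<^sub>a p \<in> Hom C (\<Sigma>\<^sub>o B) (\<Sigma>\<^sub>o X)"
    using Shift_Hom H by blast+
  \<comment> \<open>Two rotations make \<open>h\<close> and the negative of the shifted
    \<open>i\<close> consecutive arrows. After the sign is removed, composing with the shifted
    \<open>p\<close> cancels the shifted \<open>i\<close> and leaves \<open>h\<close>.\<close>
  have "neg_arr C (\<Sigma>\<^sub>a i) \<cdot> h = zero_arr C Z (\<Sigma>\<^sub>o B)"
    using distinguished_comp_zero[OF distinguished_rotate[OF d]]
      distinguished_comp_zero[OF distinguished_rotate[OF d']] by blast
  then have "\<Sigma>\<^sub>a i \<cdot> h = zero_arr C Z (\<Sigma>\<^sub>o B)"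
    using Comp_add_left[OF h Si neg_Hom[OF Si]] add_neg[OF Si] zero_Comp[OF h O(6)]
      add_zero(1)[OF Comp_Hom[OF h Si]] by simp
  then have "\<Sigma>\<^sub>a p \<cdot> (\<Sigma>\<^sub>a i \<cdot> h) = zero_arr C Z (\<Sigma>\<^sub>o X)"
    using Comp_zero[OF Sp O(4)] by simp
  moreover have "\<Sigma>\<^sub>a p \<cdot> \<Sigma>\<^sub>a i = Ident C (\<Sigma>\<^sub>o X)"
    using Shift_functor H(1,3) e(1) O(1) unfolding is_endofunctor_def by metis
  ultimately have h0: "h = zero_arr C Z (\<Sigma>\<^sub>o X)"
    using Comp_assoc[OF h Si Sp] Ident_Comp[OF h] by simp
  obtain r where r: "r \<in> Hom C Z Y" "r \<cdot> g = q"
    using distinguished_weak_cokernel[OF d H(4) e(3)] by blast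
  let ?s = "g \<cdot> j"
  have s: "?s \<in> Hom C Y Z" using Comp_Hom H g by blast
  have rs: "r \<cdot> ?s = Ident C Y" using Comp_assoc[OF H(2) g r(1)] r(2) e(2) by simp
  have sr: "?s \<cdot> r \<in> Hom C Z Z" using Comp_Hom[OF r(1) s] .
  \<comment> \<open>\<open>?u\<close> is the defect of \<open>?s \<cdot> r\<close> from the
    identity. It kills \<open>g\<close>, hence factors through \<open>h\<close>, which is
    zero.\<close>
  let ?u = "Ident C Z \<oplus> neg_arr C (?s \<cdot> r)"
  have I: "Ident C Z \<in> Hom C Z Z" using Ident_Hom O by blast
  have u: "?u \<in> Hom C Z Z" using add_Hom[OF I neg_Hom[OF sr]] .
  have gip: "g \<cdot> (i \<cdot> p) = zero_arr C B Z"
    using Comp_assoc[OF H(3,1) g] distinguished_comp_zero[OF d] zero_Comp[OF H(3) O(4)] by simp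
  have "g = g \<cdot> (i \<cdot> p \<oplus> j \<cdot> q)" using e(5) Comp_Ident[OF g] by simp
  also have "\<dots> = g \<cdot> (i \<cdot> p) \<oplus> g \<cdot> (j \<cdot> q)"
    using Comp_add_right[OF Comp_Hom[OF H(3,1)] Comp_Hom[OF H(4,2)] g] .
  also have "\<dots> = g \<cdot> (j \<cdot> q)"
    using gip add_zero(2)[OF Comp_Hom[OF Comp_Hom[OF H(4,2)] g]] by simp
  also have "\<dots> = (?s \<cdot> r) \<cdot> g"
    using Comp_assoc[OF H(4,2) g] Comp_assoc[OF g r(1) s] r(2) by simp
  finally have srg: "(?s \<cdot> r) \<cdot> g = g" by simp
  have "?u \<cdot> g = (?s \<cdot> r) \<cdot> g \<oplus> neg_arr C (?s \<cdot> r) \<cdot> g"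
    using Comp_add_left[OF g I neg_Hom[OF sr]] Ident_Comp[OF g] srg by simp
  also have "\<dots> = zero_arr C B Z"
    using Comp_add_left[OF g sr neg_Hom[OF sr]] add_neg[OF sr] zero_Comp[OF g O(4)] by simp
  finally obtain t where "t \<in> Hom C (\<Sigma>\<^sub>o X) Z" "t \<cdot> h = ?u"
    using distinguished_weak_cokernel[OF d' u] by blast
  then have "?u = ?s \<cdot> r \<oplus> neg_arr C (?s \<cdot> r)"
    using h0 Comp_zero O add_neg[OF sr] by simp
  then have "?s \<cdot> r = Ident C Z"
    using add_right_cancel[OF I sr neg_Hom[OF sr]] by simp
  then have "isomorphic C Y Z"
    unfolding isomorphic_def is_iso_def using s r rs by blast
  with d show thesis by (rule that)
qed

section \<open>Closure properties of thick subcategories\<close>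

lemma thick_dest:
  assumes "thick_subcategory C J"
  shows thick_subset: "J \<subseteq> Obj C"
    and thick_nonempty: "J \<noteq> {}"
    and thick_isomorphic: "X \<in> J \<Longrightarrow> isomorphic C X Y \<Longrightarrow> Y \<in> J"
    and thick_shift: "X \<in> Obj C \<Longrightarrow> X \<in> J \<longleftrightarrow> \<Sigma>\<^sub>o X \<in> J"
    and thick_cone: "distinguished C X Y Z f g h \<Longrightarrow> X \<in> J \<Longrightarrow> Y \<in> J \<Longrightarrow> Z \<in> J"
    and thick_summand: "is_biproduct C X Y B \<Longrightarrow> B \<in> J \<Longrightarrow> X \<in> J \<and> Y \<in> J"
  using assms unfolding thick_subcategory_def triangulated_subcategory_def by blast+

lemma thick_zero_object:
  assumes "thick_subcategory C J" "zero_object C Z"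
  shows "Z \<in> J"
proof -
  obtain X where X: "X \<in> J" using thick_nonempty[OF assms(1)] by blast
  then have "X \<in> Obj C" using thick_subset[OF assms(1)] by blast
  from thick_cone[OF assms(1) TR1_Ident[OF this assms(2)] X X] show ?thesis .
qed

text \<open>The cone condition yields only the third vertex of a triangle. Two rotations put the
  shift of \<open>B\<close> there, over the shift of \<open>X\<close> and an object isomorphic to
  \<open>Y\<close>.\<close>

lemma thick_biproduct_iff:
  assumes J: "thick_subcategory C J" and B: "is_biproduct C X Y B"
  shows "B \<in> J \<longleftrightarrow> X \<in> J \<and> Y \<in> J"
proof
  assume XY: "X \<in> J \<and> Y \<in> J"
  obtain Z f g h where d: "distinguished C X B Z f g h" and "isomorphic C Y Z"
    using cone_biproduct_injection[OF B] .
  then have Z: "Z \<in> J" using thick_isomorphic[OF J] XY by blast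
  have O: "X \<in> Obj C" "B \<in> Obj C" using Hom_Obj distinguished_Hom(1)[OF d] by blast+
  then have "\<Sigma>\<^sub>o X \<in> J" using XY thick_shift[OF J] by blast
  from thick_cone[OF J distinguished_rotate[OF distinguished_rotate[OF d]] Z this]
  show "B \<in> J" using thick_shift[OF J] O by blast
qed (rule thick_summand[OF J B])

text \<open>\<open>B\<close> is an iterated biproduct that starts from a zero object. It is chosen
  before \<open>J\<close>, so one object stands for \<open>F\<close> in all thick subcategories
  simultaneously.\<close>

lemma finite_set_sum_object:
  assumes "finite F" "F \<subseteq> Obj C"
  obtains B where "B \<in> Obj C" "\<And>J. thick_subcategory C J \<Longrightarrow> B \<in> J \<longleftrightarrow> F \<subseteq> J"
proof -
  have "\<exists>B \<in> Obj C. \<forall>J. thick_subcategory C J \<longrightarrow> (B \<in> J \<longleftrightarrow> F \<subseteq> J)"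
    using assms
  proof (induction F)
    case empty
    obtain Z where Z: "zero_object C Z" using ex_zero_object by blast
    then have "Z \<in> Obj C" unfolding zero_object_def by blast
    then show ?case using thick_zero_object[OF _ Z] by blast
  next
    case (insert X F)
    then obtain A where A: "A \<in> Obj C" "\<forall>J. thick_subcategory C J \<longrightarrow> (A \<in> J \<longleftrightarrow> F \<subseteq> J)"
      by blast
    obtain B where "B \<in> Obj C" "is_biproduct C X A B" using ex_biproduct A insert.prems by blast
    then show ?case using thick_biproduct_iff A by (intro bexI[of _ B]) auto
  qed
  then show thesis using that by blast
qed

text \<open>The comparison isomorphism \<open>\<phi>\<close> gives closure under shifts. It also
  alters the third arrow of an image triangle, but the cone condition looks only at the
  vertices.\<close>

lemma thick_vimage:
  assumes F: "exact_functor C F" and J: "thick_subcategory C J"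
  shows "thick_subcategory C {X \<in> Obj C. on_obj F X \<in> J}"
proof -
  have add: "additive_functor C F" using F unfolding exact_functor_def by blast
  then have endo: "is_endofunctor C F" unfolding additive_functor_def by blast
  obtain \<phi> where nat: "natural_iso C (comp_functor F (Shift C)) (comp_functor (Shift C) F) \<phi>"
    and dist: "\<And>X Y Z f g h. distinguished C X Y Z f g h \<Longrightarrow>
           distinguished C (on_obj F X) (on_obj F Y) (on_obj F Z)
             (on_arr F f) (on_arr F g) (\<phi> X \<cdot> on_arr F h)"
    using F unfolding exact_functor_def by blast
  have FO: "on_obj F X \<in> Obj C" if "X \<in> Obj C" for X
    using endo that unfolding is_endofunctor_def by blast
  obtain N where N: "zero_object C N" using ex_zero_object by blast
  show ?thesis
    unfolding thick_subcategory_def triangulated_subcategory_def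
  proof (intro conjI allI impI ballI)
    have "N \<in> Obj C" using N unfolding zero_object_def by blast
    then show "{X \<in> Obj C. on_obj F X \<in> J} \<noteq> {}"
      using thick_zero_object[OF J zero_object_functor[OF add N]] by blast
  next
    fix X Y assume X: "X \<in> {X \<in> Obj C. on_obj F X \<in> J}" and i: "isomorphic C X Y"
    have "Y \<in> Obj C" using i Hom_Obj unfolding isomorphic_def is_iso_def by blast
    then show "Y \<in> {X \<in> Obj C. on_obj F X \<in> J}"
      using X thick_isomorphic[OF J _ isomorphic_functor[OF endo i]] by blast
  next
    fix X assume X: "X \<in> Obj C"
    then have i: "isomorphic C (on_obj F (\<Sigma>\<^sub>o X)) (\<Sigma>\<^sub>o (on_obj F X))"
      using nat unfolding natural_iso_def isomorphic_def comp_functor_def by auto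
    have "\<Sigma>\<^sub>o X \<in> Obj C" using X Shift_functor unfolding is_endofunctor_def by blast
    then show "X \<in> {X \<in> Obj C. on_obj F X \<in> J} \<longleftrightarrow> \<Sigma>\<^sub>o X \<in> {X \<in> Obj C. on_obj F X \<in> J}"
      using X thick_shift[OF J FO[OF X]] thick_isomorphic[OF J _ i]
        thick_isomorphic[OF J _ isomorphic_sym[OF i]] by blast
  next
    fix X Y Z f g h assume d: "distinguished C X Y Z f g h"
      and "X \<in> {X \<in> Obj C. on_obj F X \<in> J}" "Y \<in> {X \<in> Obj C. on_obj F X \<in> J}"
    then show "Z \<in> {X \<in> Obj C. on_obj F X \<in> J}"
      using thick_cone[OF J dist[OF d]] Hom_Obj distinguished_Hom(2)[OF d] by blast
  next
    fix X Y B assume b: "is_biproduct C X Y B" and "B \<in> {X \<in> Obj C. on_obj F X \<in> J}"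
    moreover have "X \<in> Obj C" "Y \<in> Obj C"
      using b Hom_Obj unfolding is_biproduct_def by blast+
    ultimately show "X \<in> {X \<in> Obj C. on_obj F X \<in> J}" "Y \<in> {X \<in> Obj C. on_obj F X \<in> J}"
      using thick_summand[OF J is_biproduct_functor[OF add b]] by blast+
  qed auto
qed

text \<open>Stated for bare thick subcategories because residuals are intersections of preimages
  that need not be ideals one by one.\<close>

lemma thick_Inter:
  assumes "\<And>J. J \<in> \<J> \<Longrightarrow> thick_subcategory C J"
  shows "thick_subcategory C (Obj C \<inter> \<Inter>\<J>)"
proof -
  obtain N where N: "zero_object C N" using ex_zero_object by blast
  show ?thesis
    unfolding thick_subcategory_def triangulated_subcategory_def
  proof (intro conjI allI impI ballI)
    show "Obj C \<inter> \<Inter>\<J> \<noteq> {}"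
      using thick_zero_object[OF assms N] N unfolding zero_object_def by blast
  next
    fix X Y assume "X \<in> Obj C \<inter> \<Inter>\<J>" "isomorphic C X Y"
    then show "Y \<in> Obj C \<inter> \<Inter>\<J>"
      using thick_isomorphic[OF assms] Hom_Obj unfolding isomorphic_def is_iso_def by blast
  next
    fix X assume "X \<in> Obj C"
    then show "X \<in> Obj C \<inter> \<Inter>\<J> \<longleftrightarrow> \<Sigma>\<^sub>o X \<in> Obj C \<inter> \<Inter>\<J>"
      using thick_shift[OF assms] Shift_functor unfolding is_endofunctor_def by blast
  next
    fix X Y Z f g h
    assume d: "distinguished C X Y Z f g h" and XY: "X \<in> Obj C \<inter> \<Inter>\<J>" "Y \<in> Obj C \<inter> \<Inter>\<J>"
    have "Z \<in> J" if "J \<in> \<J>" for J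
      using thick_cone[OF assms[OF that] d] XY that by blast
    then show "Z \<in> Obj C \<inter> \<Inter>\<J>"
      using Hom_Obj distinguished_Hom(2)[OF d] by blast
  next
    fix X Y B assume b: "is_biproduct C X Y B" and "B \<in> Obj C \<inter> \<Inter>\<J>"
    moreover have "X \<in> Obj C" "Y \<in> Obj C"
      using b Hom_Obj unfolding is_biproduct_def by blast+
    ultimately show "X \<in> Obj C \<inter> \<Inter>\<J>" "Y \<in> Obj C \<inter> \<Inter>\<J>"
      using thick_summand[OF assms b] by blast+
  qed simp
qed

end


section \<open>Prime and semiprime ideals\<close>

context monoidal_triangulated_category
begin

section \<open>Preimages under tensoring, and residual ideals\<close>

lemma thick_ideal_thick: "thick_ideal K I \<Longrightarrow> thick_subcategory K I"
  by (simp add: thick_ideal_def)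

lemma isomorphic_associator:
  assumes "X \<in> Obj K" "Y \<in> Obj K" "Z \<in> Obj K"
  shows "isomorphic K (X \<otimes>\<^sub>o Y \<otimes>\<^sub>o Z) (X \<otimes>\<^sub>o (Y \<otimes>\<^sub>o Z))"
  using associator_iso[OF assms] unfolding isomorphic_def by blast

lemma isomorphic_tensor_right:
  assumes "X \<in> Obj K" "isomorphic K Y Z"
  shows "isomorphic K (Y \<otimes>\<^sub>o X) (Z \<otimes>\<^sub>o X)"
proof -
  have "is_endofunctor K (tensor_right K X)"
    using tensor_right_exact[OF assms(1)] unfolding exact_functor_def additive_functor_def by blast
  from isomorphic_functor[OF this assms(2)] show ?thesis by (simp add: tensor_right_def)
qed

lemma thick_tensor_left_vimage:
  assumes "X \<in> Obj K" "thick_subcategory K J"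
  shows "thick_subcategory K {Z \<in> Obj K. X \<otimes>\<^sub>o Z \<in> J}"
  using thick_vimage[OF tensor_left_exact[OF assms(1)] assms(2)] by (simp add: tensor_left_def)

lemma thick_tensor_right_vimage:
  assumes "X \<in> Obj K" "thick_subcategory K J"
  shows "thick_subcategory K {Z \<in> Obj K. Z \<otimes>\<^sub>o X \<in> J}"
  using thick_vimage[OF tensor_right_exact[OF assms(1)] assms(2)] by (simp add: tensor_right_def)

lemma thick_tensor_right_right_vimage:
  assumes "X \<in> Obj K" "Y \<in> Obj K" "thick_subcategory K J"
  shows "thick_subcategory K {Z \<in> Obj K. Z \<otimes>\<^sub>o Y \<otimes>\<^sub>o X \<in> J}"
proof -
  have "{Z \<in> Obj K. Z \<otimes>\<^sub>o Y \<otimes>\<^sub>o X \<in> J} = {Z \<in> Obj K. Z \<otimes>\<^sub>o Y \<in> {W \<in> Obj K. W \<otimes>\<^sub>o X \<in> J}}"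
    using tensor_Obj assms by blast
  then show ?thesis
    using thick_tensor_right_vimage[OF assms(2) thick_tensor_right_vimage[OF assms(1,3)]] by simp
qed

text \<open>For \<open>X = Y = x\<close> these are the middle factors tested in compact detection;
  thickness is what lets a direct sum replace finitely many of them.\<close>

lemma thick_tensor_left_right_vimage:
  assumes "X \<in> Obj K" "Y \<in> Obj K" "thick_subcategory K J"
  shows "thick_subcategory K {Z \<in> Obj K. Y \<otimes>\<^sub>o Z \<otimes>\<^sub>o X \<in> J}"
proof -
  have "{Z \<in> Obj K. Y \<otimes>\<^sub>o Z \<otimes>\<^sub>o X \<in> J} = {Z \<in> Obj K. Y \<otimes>\<^sub>o Z \<in> {W \<in> Obj K. W \<otimes>\<^sub>o X \<in> J}}"
    using tensor_Obj assms by blast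
  then show ?thesis
    using thick_tensor_left_vimage[OF assms(2) thick_tensor_right_vimage[OF assms(1,3)]] by simp
qed

text \<open>The middle factor makes these residuals of an ideal two-sided ideals for an arbitrary set \<open>S\<close>,
  so they replace the ideals generated by \<open>S\<close>, of which no description is needed.\<close>

definition right_residual :: "'o set \<Rightarrow> 'o set \<Rightarrow> 'o set" where
  "right_residual P S = {Z \<in> Obj K. \<forall>X \<in> S. \<forall>Y \<in> Obj K. X \<otimes>\<^sub>o Y \<otimes>\<^sub>o Z \<in> P}"

definition left_residual :: "'o set \<Rightarrow> 'o set \<Rightarrow> 'o set" where
  "left_residual P S = {Z \<in> Obj K. \<forall>X \<in> S. \<forall>Y \<in> Obj K. Z \<otimes>\<^sub>o Y \<otimes>\<^sub>o X \<in> P}"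

lemma thick_ideal_right_residual:
  assumes P: "thick_ideal K P" and S: "S \<subseteq> Obj K"
  shows "thick_ideal K (right_residual P S)"
  unfolding thick_ideal_def
proof (intro conjI ballI)
  let ?\<J> = "{{Z \<in> Obj K. X \<otimes>\<^sub>o Y \<otimes>\<^sub>o Z \<in> P} |X Y. X \<in> S \<and> Y \<in> Obj K}"
  have "right_residual P S = Obj K \<inter> \<Inter>?\<J>"
    unfolding right_residual_def by blast
  moreover have "thick_subcategory K J" if "J \<in> ?\<J>" for J
    using that S thick_tensor_left_vimage[OF tensor_Obj thick_ideal_thick[OF P]] by blast
  ultimately show "thick_subcategory K (right_residual P S)"
    using thick_Inter[of ?\<J>] by simp
next
  fix Z W assume "Z \<in> right_residual P S" and W: "W \<in> Obj K"
  then have Z: "Z \<in> Obj K" "\<And>X Y. X \<in> S \<Longrightarrow> Y \<in> Obj K \<Longrightarrow> X \<otimes>\<^sub>o Y \<otimes>\<^sub>o Z \<in> P"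
    unfolding right_residual_def by blast+
  have "X \<otimes>\<^sub>o Y \<otimes>\<^sub>o (Z \<otimes>\<^sub>o W) \<in> P" if "X \<in> S" "Y \<in> Obj K" for X Y
    using thick_ideal_isomorphic[OF P _ isomorphic_associator[OF tensor_Obj Z(1) W]]
      thick_ideal_tensor[OF P Z(2) W] that S by blast
  then show "Z \<otimes>\<^sub>o W \<in> right_residual P S"
    unfolding right_residual_def using tensor_Obj Z W by blast
  \<comment> \<open>A factor on the inner side is not absorbed by \<open>P\<close> directly. It is
    moved into the quantified middle factor, where \<open>Y \<otimes>\<^sub>o W\<close> is again an
    admissible choice.\<close>
  have "X \<otimes>\<^sub>o Y \<otimes>\<^sub>o (W \<otimes>\<^sub>o Z) \<in> P" if "X \<in> S" "Y \<in> Obj K" for X Y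
  proof -
    have X: "X \<in> Obj K" using that S by blast
    note YW = tensor_Obj[OF that(2) W]
    have "X \<otimes>\<^sub>o Y \<otimes>\<^sub>o W \<otimes>\<^sub>o Z \<in> P"
      using thick_ideal_isomorphic[OF P Z(2)[OF that(1) YW]
          isomorphic_tensor_right[OF Z(1) isomorphic_sym[OF isomorphic_associator[OF X that(2) W]]]] .
    then show ?thesis
      using thick_ideal_isomorphic[OF P _ isomorphic_associator[OF tensor_Obj[OF X that(2)] W Z(1)]]
      by blast
  qed
  then show "W \<otimes>\<^sub>o Z \<in> right_residual P S"
    unfolding right_residual_def using tensor_Obj Z W by blast
qed

lemma thick_ideal_left_residual:
  assumes P: "thick_ideal K P" and S: "S \<subseteq> Obj K"
  shows "thick_ideal K (left_residual P S)"
  unfolding thick_ideal_def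
proof (intro conjI ballI)
  let ?\<J> = "{{Z \<in> Obj K. Z \<otimes>\<^sub>o Y \<otimes>\<^sub>o X \<in> P} |X Y. X \<in> S \<and> Y \<in> Obj K}"
  have "left_residual P S = Obj K \<inter> \<Inter>?\<J>"
    unfolding left_residual_def by blast
  moreover have "thick_subcategory K J" if "J \<in> ?\<J>" for J
    using that S thick_tensor_right_right_vimage[OF _ _ thick_ideal_thick[OF P]] by blast
  ultimately show "thick_subcategory K (left_residual P S)"
    using thick_Inter[of ?\<J>] by simp
next
  fix Z W assume "Z \<in> left_residual P S" and W: "W \<in> Obj K"
  then have Z: "Z \<in> Obj K" "\<And>X Y. X \<in> S \<Longrightarrow> Y \<in> Obj K \<Longrightarrow> Z \<otimes>\<^sub>o Y \<otimes>\<^sub>o X \<in> P"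
    unfolding left_residual_def by blast+
  have "Z \<otimes>\<^sub>o W \<otimes>\<^sub>o Y \<otimes>\<^sub>o X \<in> P" if "X \<in> S" "Y \<in> Obj K" for X Y
    using thick_ideal_isomorphic[OF P Z(2)[OF that(1) tensor_Obj[OF W that(2)]]
        isomorphic_tensor_right[OF _ isomorphic_sym[OF isomorphic_associator[OF Z(1) W that(2)]]]]
      that S by blast
  then show "Z \<otimes>\<^sub>o W \<in> left_residual P S"
    unfolding left_residual_def using tensor_Obj Z W by blast
  have "W \<otimes>\<^sub>o Z \<otimes>\<^sub>o Y \<otimes>\<^sub>o X \<in> P" if "X \<in> S" "Y \<in> Obj K" for X Y
  proof -
    have X: "X \<in> Obj K" using that S by blast
    have "W \<otimes>\<^sub>o (Z \<otimes>\<^sub>o Y \<otimes>\<^sub>o X) \<in> P"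
      using thick_ideal_tensor[OF P Z(2)[OF that] W] by blast
    then have "W \<otimes>\<^sub>o (Z \<otimes>\<^sub>o Y) \<otimes>\<^sub>o X \<in> P"
      using thick_ideal_isomorphic[OF P]
        isomorphic_sym[OF isomorphic_associator[OF W tensor_Obj[OF Z(1) that(2)] X]] by blast
    then show ?thesis
      using thick_ideal_isomorphic[OF P]
        isomorphic_tensor_right[OF X isomorphic_sym[OF isomorphic_associator[OF W Z(1) that(2)]]] by blast
  qed
  then show "W \<otimes>\<^sub>o Z \<in> left_residual P S"
    unfolding left_residual_def using tensor_Obj Z W by blast
qed

section \<open>Testing semiprimeness on the objects x \<otimes> y \<otimes> x\<close>

lemma prime_ideal_tensor_square:
  assumes P: "prime_ideal K P" and x: "x \<in> Obj K"
    and sq: "\<And>y. y \<in> Obj K \<Longrightarrow> x \<otimes>\<^sub>o y \<otimes>\<^sub>o x \<in> P"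
  shows "x \<in> P"
proof -
  have tP: "thick_ideal K P" using P unfolding prime_ideal_def by blast
  \<comment> \<open>Primeness needs two ideals that both contain \<open>x\<close> and have their
    product in \<open>P\<close>. The hypothesis puts \<open>x\<close> into \<open>A\<close>, and the
    definition of \<open>A\<close> puts \<open>x\<close> into \<open>B\<close>.\<close>
  define A where "A = right_residual P {x}"
  define B where "B = left_residual P A"
  have A: "thick_ideal K A" unfolding A_def using thick_ideal_right_residual[OF tP] x by blast
  have B: "thick_ideal K B"
    unfolding B_def using thick_ideal_left_residual[OF tP thick_ideal_subset[OF A]] .
  have xA: "x \<in> A" unfolding A_def right_residual_def using x sq by blast
  have xB: "x \<in> B" unfolding B_def left_residual_def using x A_def right_residual_def by blast
  have "b \<otimes>\<^sub>o a \<in> P" if "b \<in> B" "a \<in> A" for a b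
  proof -
    have O: "a \<in> Obj K" "b \<in> Obj K" using that thick_ideal_subset A B by blast+
    \<comment> \<open>The unit as middle factor turns the threefold product of the residual into the
      plain product required by primeness.\<close>
    have "b \<otimes>\<^sub>o unit_obj K \<otimes>\<^sub>o a \<in> P"
      using that unit_Obj unfolding B_def left_residual_def by blast
    moreover have "isomorphic K (b \<otimes>\<^sub>o unit_obj K \<otimes>\<^sub>o a) (b \<otimes>\<^sub>o a)"
      using isomorphic_tensor_right[OF O(1)] right_unitor_iso[OF O(2)] unfolding isomorphic_def by blast
    ultimately show ?thesis using thick_ideal_isomorphic[OF tP] by blast
  qed
  then have "{X \<otimes>\<^sub>o Y |X Y. X \<in> B \<and> Y \<in> A} \<subseteq> P" by blast
  then have "B \<subseteq> P \<or> A \<subseteq> P" using P A B unfolding prime_ideal_def by blast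
  then show ?thesis using xA xB by blast
qed

lemma semiprime_ideal_tensor_square:
  assumes "semiprime_ideal K I" and "x \<in> Obj K"
    and "\<And>y. y \<in> Obj K \<Longrightarrow> x \<otimes>\<^sub>o y \<otimes>\<^sub>o x \<in> I"
  shows "x \<in> I"
proof -
  obtain \<P> where "\<forall>P \<in> \<P>. prime_ideal K P" "I = Obj K \<inter> \<Inter>\<P>"
    using assms(1) unfolding semiprime_ideal_def by blast
  then show ?thesis using prime_ideal_tensor_square[of _ x] assms(2,3) by blast
qed

text \<open>Cones are the only closure condition with two membership hypotheses, and directedness
  brings both into one member. Chains for Zorn's lemma and families of finite joins are both
  covered.\<close>

lemma thick_ideal_directed_Union:
  assumes I: "\<And>I. I \<in> \<I> \<Longrightarrow> thick_ideal K I" and ne: "\<I> \<noteq> {}"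
    and directed: "\<And>I J. I \<in> \<I> \<Longrightarrow> J \<in> \<I> \<Longrightarrow> \<exists>L \<in> \<I>. I \<subseteq> L \<and> J \<subseteq> L"
  shows "thick_ideal K (\<Union>\<I>)"
  unfolding thick_ideal_unfold
proof (intro conjI allI impI ballI)
  show "\<Union>\<I> \<subseteq> Obj K" using thick_ideal_subset[OF I] by blast
  show "\<Union>\<I> \<noteq> {}" using thick_ideal_nonempty[OF I] ne by blast
next
  fix X Y assume "X \<in> \<Union>\<I>" "isomorphic K X Y"
  then show "Y \<in> \<Union>\<I>" using thick_ideal_isomorphic[OF I] by blast
next
  fix X assume "X \<in> Obj K"
  then show "X \<in> \<Union>\<I> \<longleftrightarrow> \<Sigma>\<^sub>o X \<in> \<Union>\<I>" using thick_ideal_shift[OF I] by blast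
next
  fix X Y Z f g h assume d: "distinguished K X Y Z f g h" and "X \<in> \<Union>\<I>" "Y \<in> \<Union>\<I>"
  then obtain L where "L \<in> \<I>" "X \<in> L" "Y \<in> L" using directed by (meson UnionE subsetD)
  then show "Z \<in> \<Union>\<I>" using thick_ideal_cone[OF I d] by blast
next
  fix X Y B assume b: "is_biproduct K X Y B" and "B \<in> \<Union>\<I>"
  then show "X \<in> \<Union>\<I>" "Y \<in> \<Union>\<I>" using thick_ideal_summand[OF I b] by blast+
next
  fix X Y assume "X \<in> \<Union>\<I>" "Y \<in> Obj K"
  then show "X \<otimes>\<^sub>o Y \<in> \<Union>\<I>" "Y \<otimes>\<^sub>o X \<in> \<Union>\<I>" using thick_ideal_tensor[OF I] by blast+
qed

text \<open>The noncommutative analogue of avoiding the powers of \<open>x\<close>: a sequence with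
  \<open>m (n + 1) = m n \<otimes> y \<otimes> m n\<close> that stays outside \<open>I\<close>, and an ideal maximal among those
  avoiding it.\<close>

lemma prime_ideal_avoiding:
  assumes I: "thick_ideal K I" and x: "x \<in> Obj K" "x \<notin> I"
    and sq: "\<And>x. x \<in> Obj K \<Longrightarrow> (\<And>y. y \<in> Obj K \<Longrightarrow> x \<otimes>\<^sub>o y \<otimes>\<^sub>o x \<in> I) \<Longrightarrow> x \<in> I"
  obtains P where "prime_ideal K P" "I \<subseteq> P" "x \<notin> P"
proof -
  have "\<forall>z. \<exists>y. z \<in> Obj K - I \<longrightarrow> y \<in> Obj K \<and> z \<otimes>\<^sub>o y \<otimes>\<^sub>o z \<notin> I"
    using sq by blast
  then obtain f where f: "\<And>z. z \<in> Obj K - I \<Longrightarrow> f z \<in> Obj K \<and> z \<otimes>\<^sub>o f z \<otimes>\<^sub>o z \<notin> I"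
    by metis
  define m where "m n = ((\<lambda>z. z \<otimes>\<^sub>o f z \<otimes>\<^sub>o z) ^^ n) x" for n
  have m0: "m 0 = x" and mSuc: "m (Suc n) = m n \<otimes>\<^sub>o f (m n) \<otimes>\<^sub>o m n" for n
    unfolding m_def by simp_all
  have m: "m n \<in> Obj K - I" for n
  proof (induction n)
    case (Suc n)
    then show ?case using f[OF Suc] tensor_Obj unfolding mSuc by blast
  qed (use x m0 in simp)
  \<comment> \<open>Each term is a factor of the next, so an ideal that contains one term contains
    all later ones.\<close>
  have mono: "m (n + k) \<in> J" if "thick_ideal K J" "m n \<in> J" for J n k
  proof (induction k)
    case (Suc k)
    then show ?case
      using thick_ideal_tensor[OF that(1)] f[OF m] m[of "n + k"] tensor_Obj by (simp add: mSuc)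
  qed (use that in simp)
  define \<A> where "\<A> = {J. thick_ideal K J \<and> I \<subseteq> J \<and> J \<inter> range m = {}}"
  have "\<exists>P \<in> \<A>. \<forall>J \<in> \<A>. P \<subseteq> J \<longrightarrow> J = P"
  proof (rule subset_Zorn_nonempty)
    have "I \<in> \<A>" unfolding \<A>_def using I m by blast
    then show "\<A> \<noteq> {}" by blast
    fix \<C> assume ne: "\<C> \<noteq> {}" and chain: "subset.chain \<A> \<C>"
    have "thick_ideal K (\<Union>\<C>)"
    proof (rule thick_ideal_directed_Union[OF _ ne])
      show "thick_ideal K J" if "J \<in> \<C>" for J
        using that chain unfolding subset.chain_def \<A>_def by blast
      show "\<exists>L \<in> \<C>. J \<subseteq> L \<and> J' \<subseteq> L" if "J \<in> \<C>" "J' \<in> \<C>" for J J'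
        using that subset.chain_total[OF chain that] by blast
    qed
    then show "\<Union>\<C> \<in> \<A>"
      using ne chain unfolding subset.chain_def \<A>_def by blast
  qed
  then obtain P where P: "P \<in> \<A>" and max: "\<And>J. J \<in> \<A> \<Longrightarrow> P \<subseteq> J \<Longrightarrow> J = P" by blast
  have tP: "thick_ideal K P" and IP: "I \<subseteq> P" and Pm: "P \<inter> range m = {}"
    using P unfolding \<A>_def by blast+
  \<comment> \<open>Such a \<open>J\<close> contains \<open>I\<close> and properly contains the
    maximal \<open>P\<close>, so avoiding the sequence is the only condition of \<open>\<A>\<close>
    that it can violate.\<close>
  have meets: "\<exists>n. m n \<in> J" if "thick_ideal K J" "P \<subseteq> J" "\<not> J \<subseteq> P" for J
    using that IP max[of J] unfolding \<A>_def by blast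
  have "prime_ideal K P"
    unfolding prime_ideal_def
  proof (intro conjI allI impI tP)
    show "P \<noteq> Obj K" using Pm m by blast
    fix J1 J2 assume J: "thick_ideal K J1" "thick_ideal K J2"
      and prod: "{X \<otimes>\<^sub>o Y |X Y. X \<in> J1 \<and> Y \<in> J2} \<subseteq> P"
    note JO = thick_ideal_subset[OF J(1)] thick_ideal_subset[OF J(2)] thick_ideal_subset[OF tP]
    \<comment> \<open>\<open>A\<close> contains \<open>P\<close> and \<open>J2\<close>,
      \<open>B\<close> contains \<open>P\<close> and \<open>J1\<close>, and every product of an
      object of \<open>B\<close>, any middle factor and an object of \<open>A\<close> lies in
      \<open>P\<close>.\<close>
    define A where "A = right_residual P J1"
    define B where "B = left_residual P A"
    have A: "thick_ideal K A" unfolding A_def using thick_ideal_right_residual[OF tP JO(1)] .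
    note AO = thick_ideal_subset[OF A]
    have B: "thick_ideal K B" unfolding B_def using thick_ideal_left_residual[OF tP AO] .
    have memA: "Z \<in> A"
      if "Z \<in> Obj K" "\<And>X Y. X \<in> J1 \<Longrightarrow> Y \<in> Obj K \<Longrightarrow> X \<otimes>\<^sub>o Y \<otimes>\<^sub>o Z \<in> P" for Z
      using that unfolding A_def right_residual_def by simp
    have memB: "Z \<in> B"
      if "Z \<in> Obj K" "\<And>X Y. X \<in> A \<Longrightarrow> Y \<in> Obj K \<Longrightarrow> Z \<otimes>\<^sub>o Y \<otimes>\<^sub>o X \<in> P" for Z
      using that unfolding B_def left_residual_def by simp
    have PA: "P \<subseteq> A"
    proof
      fix Z assume "Z \<in> P"
      then have "X \<otimes>\<^sub>o Y \<otimes>\<^sub>o Z \<in> P" if "X \<in> J1" "Y \<in> Obj K" for X Y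
        using thick_ideal_tensor[OF tP] tensor_Obj that JO(1) by (simp add: subsetD)
      then show "Z \<in> A" using memA \<open>Z \<in> P\<close> JO by (simp add: subsetD)
    qed
    have PB: "P \<subseteq> B"
    proof
      fix Z assume "Z \<in> P"
      then have "Z \<otimes>\<^sub>o Y \<otimes>\<^sub>o X \<in> P" if "X \<in> A" "Y \<in> Obj K" for X Y
        using thick_ideal_tensor[OF tP] that AO by (simp add: subsetD)
      then show "Z \<in> B" using memB \<open>Z \<in> P\<close> JO by (simp add: subsetD)
    qed
    have JA: "J2 \<subseteq> A"
    proof
      fix Z assume Z: "Z \<in> J2"
      have "X \<otimes>\<^sub>o Y \<otimes>\<^sub>o Z \<in> P" if "X \<in> J1" "Y \<in> Obj K" for X Y
        using thick_ideal_tensor[OF J(1) that] Z prod by blast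
      then show "Z \<in> A" using memA Z JO by blast
    qed
    have JB: "J1 \<subseteq> B"
    proof
      fix Z assume Z: "Z \<in> J1"
      have "Z \<otimes>\<^sub>o Y \<otimes>\<^sub>o X \<in> P" if "X \<in> A" "Y \<in> Obj K" for X Y
        using that Z unfolding A_def right_residual_def by simp
      then show "Z \<in> B" using memB Z JO by blast
    qed
    show "J1 \<subseteq> P \<or> J2 \<subseteq> P"
    proof (rule ccontr)
      assume "\<not> (J1 \<subseteq> P \<or> J2 \<subseteq> P)"
      then have "\<not> B \<subseteq> P" "\<not> A \<subseteq> P" using JA JB by blast+
      then obtain k n where "m k \<in> B" "m n \<in> A" using meets[OF A PA] meets[OF B PB] by blast
      \<comment> \<open>At the common index, one term serves as left factor from \<open>B\<close>
        and as right factor from \<open>A\<close>; the next term is this product with a middle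
        factor and thus falls into \<open>P\<close>.\<close>
      then have "m (k + n) \<in> B" "m (k + n) \<in> A"
        using mono[OF B, of k n] mono[OF A, of n k] by (simp_all add: add.commute)
      then have "m (Suc (k + n)) \<in> P"
        using f[OF m] unfolding mSuc B_def left_residual_def by blast
      then show False using Pm by blast
    qed
  qed
  moreover have "x \<notin> P" using Pm m0 by (metis disjoint_iff rangeI)
  ultimately show thesis using IP that by blast
qed

text \<open>The right-hand side mentions no primes, so it can be checked for a union of ideals,
  where no family of primes is at hand.\<close>

lemma semiprime_ideal_iff:
  "semiprime_ideal K I \<longleftrightarrow> thick_ideal K I \<and>
     (\<forall>x \<in> Obj K. (\<forall>y \<in> Obj K. x \<otimes>\<^sub>o y \<otimes>\<^sub>o x \<in> I) \<longrightarrow> x \<in> I)" (is "?L \<longleftrightarrow> ?R")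
proof
  show "?L \<Longrightarrow> ?R" using semiprime_ideal_tensor_square unfolding semiprime_ideal_def by blast
  assume R: ?R
  let ?\<P> = "{P. prime_ideal K P \<and> I \<subseteq> P}"
  have "x \<in> I" if x: "x \<in> Obj K \<inter> \<Inter>?\<P>" for x
  proof (rule ccontr)
    assume "x \<notin> I"
    then obtain P where "prime_ideal K P" "I \<subseteq> P" "x \<notin> P"
      using prime_ideal_avoiding[of I x] R x by (metis IntD1)
    then show False using x by blast
  qed
  then have "I = Obj K \<inter> \<Inter>?\<P>" using R thick_ideal_subset by blast
  moreover have "\<forall>P \<in> ?\<P>. prime_ideal K P" by simp
  ultimately show ?L
    unfolding semiprime_ideal_def using conjunct1[OF R] by (intro conjI exI[of _ ?\<P>])
qed


section \<open>Compact elements\<close>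

lemma compact_element_semiprime_iff:
  "compact_element (semiprime_lattice K) c \<longleftrightarrow> semiprime_ideal K c \<and>
     (\<forall>S. (\<forall>I \<in> S. semiprime_ideal K I) \<longrightarrow> c \<subseteq> semiprime_hull K (\<Union>S) \<longrightarrow>
        (\<exists>S'. S' \<subseteq> S \<and> finite S' \<and> c \<subseteq> semiprime_hull K (\<Union>S')))"
proof -
  have carrier: "S \<subseteq> carrier (semiprime_lattice K) \<longleftrightarrow> (\<forall>I \<in> S. semiprime_ideal K I)" for S
    by (auto simp: semiprime_lattice_def)
  have le_sup: "c \<sqsubseteq>\<^bsub>semiprime_lattice K\<^esub> \<Squnion>\<^bsub>semiprime_lattice K\<^esub> S \<longleftrightarrow> c \<subseteq> semiprime_hull K (\<Union>S)"
    if "\<forall>I \<in> S. semiprime_ideal K I" for S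
  proof -
    have "\<Squnion>\<^bsub>semiprime_lattice K\<^esub> S = semiprime_hull K (\<Union>S)"
      using that sup_semiprime_lattice carrier by blast
    then show ?thesis by (simp add: semiprime_lattice_def)
  qed
  have "(\<exists>S'. S' \<subseteq> S \<and> finite S' \<and> c \<sqsubseteq>\<^bsub>semiprime_lattice K\<^esub> \<Squnion>\<^bsub>semiprime_lattice K\<^esub> S') \<longleftrightarrow>
      (\<exists>S'. S' \<subseteq> S \<and> finite S' \<and> c \<subseteq> semiprime_hull K (\<Union>S'))"
    if S: "\<forall>I \<in> S. semiprime_ideal K I" for S
  \<comment> \<open>\<open>conj_cong\<close> hands \<open>S' \<subseteq> S\<close> to the last
    conjunct, where it is needed to identify the join with the hull.\<close>
  proof (intro ex_cong1 conj_cong refl le_sup)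
    show "\<forall>I \<in> S'. semiprime_ideal K I" if "S' \<subseteq> S" for S'
      using that S by blast
  qed
  moreover have "c \<in> carrier (semiprime_lattice K) \<longleftrightarrow> semiprime_ideal K c"
    by (simp add: semiprime_lattice_def)
  ultimately show ?thesis
    unfolding compact_element_def carrier by (simp add: le_sup cong: imp_cong)
qed

lemma compact_semiprime_principal:
  assumes "compact_element (semiprime_lattice K) c"
  obtains x where "x \<in> Obj K" "c = semiprime_hull K {x}"
proof -
  have c: "semiprime_ideal K c" and compact:
    "\<And>S. (\<forall>I \<in> S. semiprime_ideal K I) \<Longrightarrow> c \<subseteq> semiprime_hull K (\<Union>S) \<Longrightarrow>
        \<exists>S'. S' \<subseteq> S \<and> finite S' \<and> c \<subseteq> semiprime_hull K (\<Union>S')"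
    using assms unfolding compact_element_semiprime_iff by blast+
  note cO = semiprime_ideal_subset[OF c]
  let ?h = "\<lambda>x. semiprime_hull K {x}"
  have h: "semiprime_ideal K (?h x)" "x \<in> ?h x" "\<And>I. semiprime_ideal K I \<Longrightarrow> x \<in> I \<Longrightarrow> ?h x \<subseteq> I"
    if "x \<in> Obj K" for x
    using semiprime_hull[of "{x}"] that by simp_all
  have UO: "\<Union>(?h ` F) \<subseteq> Obj K" if "F \<subseteq> Obj K" for F
    using that semiprime_ideal_subset[OF h(1)] by blast
  \<comment> \<open>Any \<open>c\<close> lies below the join of the principal ideals of its own
    objects; compactness selects finitely many of these.\<close>
  have "c \<subseteq> semiprime_hull K (\<Union>(?h ` c))"
    using semiprime_hull(2)[OF UO[OF cO]] h(2) cO by blast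
  then obtain S' where S': "S' \<subseteq> ?h ` c" "finite S'" "c \<subseteq> semiprime_hull K (\<Union>S')"
    using compact[of "?h ` c"] h(1) cO by blast
  obtain F where F: "F \<subseteq> c" "finite F" "S' = ?h ` F"
    using finite_subset_image[OF S'(2,1)] by blast
  have FO: "F \<subseteq> Obj K" using F cO by blast
  obtain b where b: "b \<in> Obj K" "\<And>J. thick_subcategory K J \<Longrightarrow> b \<in> J \<longleftrightarrow> F \<subseteq> J"
    using finite_set_sum_object[OF F(2) FO] by blast
  have b': "b \<in> I \<longleftrightarrow> F \<subseteq> I" if "semiprime_ideal K I" for I
    using b(2) that thick_ideal_thick unfolding semiprime_ideal_def by blast
  have "?h b \<subseteq> c" using h(3)[OF b(1) c] b'[OF c] F by blast
  moreover have "semiprime_hull K (\<Union>S') \<subseteq> ?h b"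
  proof (rule semiprime_hull(3)[OF _ h(1)[OF b(1)]])
    show "\<Union>S' \<subseteq> Obj K" using UO[OF FO] F by blast
    show "\<Union>S' \<subseteq> ?h b"
      using F h(3)[OF _ h(1)[OF b(1)]] b'[OF h(1)[OF b(1)]] h(2)[OF b(1)] FO by blast
  qed
  ultimately show thesis using that b(1) S'(3) by blast
qed

lemma principal_compact_if_detection:
  assumes det: "compact_detection K" and x: "x \<in> Obj K"
  shows "compact_element (semiprime_lattice K) (semiprime_hull K {x})"
  unfolding compact_element_semiprime_iff
proof (intro conjI allI impI)
  have hx: "semiprime_ideal K (semiprime_hull K {x})" "x \<in> semiprime_hull K {x}"
    "\<And>I. semiprime_ideal K I \<Longrightarrow> x \<in> I \<Longrightarrow> semiprime_hull K {x} \<subseteq> I"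
    using semiprime_hull[of "{x}"] x by simp_all
  show "semiprime_ideal K (semiprime_hull K {x})" by (rule hx)
  fix S assume S: "\<forall>I \<in> S. semiprime_ideal K I" and le: "semiprime_hull K {x} \<subseteq> semiprime_hull K (\<Union>S)"
  \<comment> \<open>The joins of finite subfamilies are directed. Once their union is semiprime it
    contains the full join, so \<open>x\<close> already lies in one of them.\<close>
  let ?\<H> = "{semiprime_hull K (\<Union>S') |S'. S' \<subseteq> S \<and> finite S'}"
  have UO: "\<Union>S' \<subseteq> Obj K" if "S' \<subseteq> S" for S'
    using that S semiprime_ideal_subset by blast
  note hull = semiprime_hull[OF UO]
  have sp: "semiprime_ideal K H" if "H \<in> ?\<H>" for H using that hull(1) by blast
  have "thick_ideal K (\<Union>?\<H>)"
  proof (rule thick_ideal_directed_Union)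
    show "thick_ideal K H" if "H \<in> ?\<H>" for H
      using sp[OF that] unfolding semiprime_ideal_def by blast
    show "?\<H> \<noteq> {}" by blast
    fix H H' assume "H \<in> ?\<H>" "H' \<in> ?\<H>"
    then obtain A B where AB: "A \<subseteq> S" "finite A" "H = semiprime_hull K (\<Union>A)"
      "B \<subseteq> S" "finite B" "H' = semiprime_hull K (\<Union>B)" by blast
    let ?U = "A \<union> B"
    have U: "?U \<subseteq> S" using AB by blast
    have "\<Union>A \<subseteq> semiprime_hull K (\<Union>?U)" "\<Union>B \<subseteq> semiprime_hull K (\<Union>?U)"
      using hull(2)[OF U] by blast+
    then have "H \<subseteq> semiprime_hull K (\<Union>?U)" "H' \<subseteq> semiprime_hull K (\<Union>?U)"
      unfolding AB using hull(3)[OF _ hull(1)[OF U]] AB by blast+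
    moreover have "semiprime_hull K (\<Union>?U) \<in> ?\<H>" using U AB by blast
    ultimately show "\<exists>L \<in> ?\<H>. H \<subseteq> L \<and> H' \<subseteq> L" by blast
  qed
  moreover have "z \<in> \<Union>?\<H>"
    if z: "z \<in> Obj K" and sq: "\<forall>y \<in> Obj K. z \<otimes>\<^sub>o y \<otimes>\<^sub>o z \<in> \<Union>?\<H>" for z
  proof -
    obtain s where s: "s \<in> Obj K"
      "\<And>I. semiprime_ideal K I \<Longrightarrow> z \<in> I \<longleftrightarrow> z \<otimes>\<^sub>o s \<otimes>\<^sub>o z \<in> I"
      using det z unfolding compact_detection_def by blast
    have "z \<otimes>\<^sub>o s \<otimes>\<^sub>o z \<in> \<Union>?\<H>" using sq s(1) by (rule bspec)
    then obtain H where H: "H \<in> ?\<H>" "z \<otimes>\<^sub>o s \<otimes>\<^sub>o z \<in> H" by (rule UnionE)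
    \<comment> \<open>Detection is applied inside the member \<open>H\<close>, which is semiprime;
      for the union this is still to be shown.\<close>
    then have "z \<in> H" using s(2)[OF sp] by simp
    with H(1) show ?thesis by (rule UnionI)
  qed
  ultimately have "semiprime_ideal K (\<Union>?\<H>)" unfolding semiprime_ideal_iff by blast
  moreover have "\<Union>S \<subseteq> \<Union>?\<H>"
  proof
    fix z assume "z \<in> \<Union>S"
    then obtain I where I: "I \<in> S" "z \<in> I" by blast
    then have "{I} \<subseteq> S" by blast
    then have "z \<in> semiprime_hull K (\<Union>{I})" using hull(2) I by blast
    then show "z \<in> \<Union>?\<H>" using \<open>{I} \<subseteq> S\<close> by blast
  qed
  ultimately have "semiprime_hull K (\<Union>S) \<subseteq> \<Union>?\<H>" using hull(3)[OF order_refl] by blast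
  then have "x \<in> \<Union>?\<H>" using le hx(2) by blast
  then obtain S' where "S' \<subseteq> S" "finite S'" "x \<in> semiprime_hull K (\<Union>S')" by blast
  then show "\<exists>S'. S' \<subseteq> S \<and> finite S' \<and> semiprime_hull K {x} \<subseteq> semiprime_hull K (\<Union>S')"
    using hx(3) hull(1) by blast
qed

lemma detection_if_principal_compact:
  assumes compact: "\<And>x. x \<in> Obj K \<Longrightarrow> compact_element (semiprime_lattice K) (semiprime_hull K {x})"
  shows "compact_detection K"
  unfolding compact_detection_def
proof
  fix x assume x: "x \<in> Obj K"
  let ?h = "\<lambda>y. semiprime_hull K {x \<otimes>\<^sub>o y \<otimes>\<^sub>o x}"
  have xyx: "{x \<otimes>\<^sub>o y \<otimes>\<^sub>o x} \<subseteq> Obj K" if "y \<in> Obj K" for y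
    using tensor_Obj[OF tensor_Obj[OF x that] x] by simp
  have h: "semiprime_ideal K (?h y)" "x \<otimes>\<^sub>o y \<otimes>\<^sub>o x \<in> ?h y"
    "\<And>I. semiprime_ideal K I \<Longrightarrow> x \<otimes>\<^sub>o y \<otimes>\<^sub>o x \<in> I \<Longrightarrow> ?h y \<subseteq> I"
    if "y \<in> Obj K" for y
    using semiprime_hull[OF xyx[OF that]] by simp_all
  have UO: "\<Union>(?h ` F) \<subseteq> Obj K" if "F \<subseteq> Obj K" for F
    using that semiprime_ideal_subset[OF h(1)] by blast
  let ?S = "?h ` Obj K"
  note hull = semiprime_hull[OF UO[OF order_refl]]
  \<comment> \<open>The join contains \<open>x \<otimes>\<^sub>o y \<otimes>\<^sub>o x\<close> for
    all \<open>y\<close>, and it is semiprime by construction.\<close>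
  have "x \<in> semiprime_hull K (\<Union>?S)"
    using semiprime_ideal_tensor_square[OF hull(1) x] hull(2) h(2) by blast
  then have "semiprime_hull K {x} \<subseteq> semiprime_hull K (\<Union>?S)"
    using semiprime_hull(3)[of "{x}", OF _ hull(1)] x by blast
  moreover have "\<forall>I \<in> ?S. semiprime_ideal K I" using h(1) by simp
  ultimately obtain S' where S': "S' \<subseteq> ?S" "finite S'" "semiprime_hull K {x} \<subseteq> semiprime_hull K (\<Union>S')"
    using conjunct2[OF compact[OF x, unfolded compact_element_semiprime_iff], rule_format, of ?S]
    by blast
  \<comment> \<open>Compactness returns ideals, whereas detection asks for an object, so a middle
    factor is chosen for each of the finitely many ideals.\<close>
  obtain F where F: "F \<subseteq> Obj K" "finite F" "S' = ?h ` F"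
    using finite_subset_image[OF S'(2,1)] by blast
  obtain s where s: "s \<in> Obj K" "\<And>J. thick_subcategory K J \<Longrightarrow> s \<in> J \<longleftrightarrow> F \<subseteq> J"
    using finite_set_sum_object[OF F(2,1)] by blast
  show "\<exists>s \<in> Obj K. \<forall>I. semiprime_ideal K I \<longrightarrow> (x \<in> I \<longleftrightarrow> x \<otimes>\<^sub>o s \<otimes>\<^sub>o x \<in> I)"
  proof (intro bexI[OF _ s(1)] allI impI iffI)
    fix I assume I: "semiprime_ideal K I"
    then have tI: "thick_ideal K I" unfolding semiprime_ideal_def by blast
    show "x \<otimes>\<^sub>o s \<otimes>\<^sub>o x \<in> I" if "x \<in> I"
      using thick_ideal_tensor[OF tI that tensor_Obj] thick_ideal_tensor[OF tI] that s x by blast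
    assume "x \<otimes>\<^sub>o s \<otimes>\<^sub>o x \<in> I"
    \<comment> \<open>The set on the right is thick and contains the sum \<open>s\<close>, hence all
      its summands.\<close>
    then have "F \<subseteq> {z \<in> Obj K. x \<otimes>\<^sub>o z \<otimes>\<^sub>o x \<in> I}"
      using s thick_tensor_left_right_vimage[OF x x thick_ideal_thick[OF tI]] by blast
    then have "\<Union>S' \<subseteq> I" using F h(3)[OF _ I] by blast
    then have "semiprime_hull K (\<Union>S') \<subseteq> I" using semiprime_hull(3)[OF UO[OF F(1)] I] F by blast
    then show "x \<in> I" using S'(3) semiprime_hull(2)[of "{x}"] x by blast
  qed
qed

text \<open>One inclusion between the two sets holds unconditionally, so their equality amounts to
  compactness of all principal ideals.\<close>

lemma compact_semiprime_iff_detection: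
  "{c. compact_element (semiprime_lattice K) c} = {semiprime_hull K {x} |x. x \<in> Obj K}
     \<longleftrightarrow> compact_detection K"
  using compact_semiprime_principal principal_compact_if_detection detection_if_principal_compact
  by blast

end

theorem proposition5p13:
  fixes K :: "('o, 'a) monoidal_triangulated_category"
  assumes "monoidal_triangulated_category K"
  shows "{c. compact_element (semiprime_lattice K) c} = {semiprime_hull K {x} |x. x \<in> Obj K}
         \<longleftrightarrow> compact_detection K"
  using assms by (rule monoidal_triangulated_category.compact_semiprime_iff_detection)

end
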